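(* Let $\Bbbk$ be a field, let $S=\Bbbk[x_1,\ldots,x_n]$ be a polynomial ring with the standard grading, and let $P\subseteq S$ be a non-degenerate homogeneous prime ideal of height $h$. Then the number of linearly independent quadrics contained in $P$ is at most $2h^2+h$, that is, $\dim_\Bbbk(P_2)\leq 2h^2+h$, where $P_2$ is the $\Bbbk$-vector space of homogeneous elements of degree $2$ in $P$.
   Context: The standard grading on $S=\Bbbk[x_1,\ldots,x_n]$ has $\deg(x_i)=1$ for all $i$. A homogeneous prime ideal $P\subseteq S$ is non-degenerate if it contains no nonzero linear form. A quadric is a homogeneous polynomial of degree $2$. *)

theory Defs
  imports
    "HOL-Algebra.Ideal"
    "HOL-Library.Poly_Mapping"
    "HOL-Library.Extended_Nat"
begin

section \<open>Polynomials in finitely many variables\<close>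

text \<open>
  A monomial is a finitely supported exponent function, and a polynomial in countably many
  variables is a finitely supported coefficient function on monomials. The polynomial ring in
  \<open>n\<close> variables consists of the polynomials that only involve the variables with indices
  \<open>0, \<dots>, n - 1\<close>; the operations are those of the type.
\<close>

type_synonym 'k mpoly = "(nat \<Rightarrow>\<^sub>0 nat) \<Rightarrow>\<^sub>0 'k"

definition mpoly_ring :: "nat \<Rightarrow> 'k::comm_ring_1 mpoly ring" where
  "mpoly_ring n =
    \<lparr>carrier = {p. \<forall>m\<in>Poly_Mapping.keys p. Poly_Mapping.keys m \<subseteq> {..<n}},
     monoid.mult = (*), one = 1, ring.zero = 0, add = (+)\<rparr>"

lemma cring_mpoly_ring: "cring (mpoly_ring n :: 'k::comm_ring_1 mpoly ring)"
proof -
  have keys_nat_add: "Poly_Mapping.keys (a + b) = Poly_Mapping.keys a \<union> Poly_Mapping.keys b"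
    for a b :: "nat \<Rightarrow>\<^sub>0 nat"
    by (auto simp: in_keys_iff lookup_add)
  have uminus: "\<exists>q\<in>carrier (mpoly_ring n). p + q = 0"
    if "p \<in> carrier (mpoly_ring n)" for p :: "'k mpoly"
    using that by (intro bexI[of _ "- p"]) (auto simp: mpoly_ring_def)
  show ?thesis
  proof (intro cringI abelian_groupI comm_monoidI)
    fix p q :: "'k mpoly"
    assume *: "p \<in> carrier (mpoly_ring n)" "q \<in> carrier (mpoly_ring n)"
    show "p \<oplus>\<^bsub>mpoly_ring n\<^esub> q \<in> carrier (mpoly_ring n)"
      using * keys_add[of p q] by (fastforce simp: mpoly_ring_def)
    show "p \<otimes>\<^bsub>mpoly_ring n\<^esub> q \<in> carrier (mpoly_ring n)"
    proof -
      have "Poly_Mapping.keys m \<subseteq> {..<n}" if m: "m \<in> Poly_Mapping.keys (p * q)" for m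
      proof -
        obtain a b where "a \<in> Poly_Mapping.keys p" "b \<in> Poly_Mapping.keys q" "m = a + b"
          using m keys_mult[of p q] by blast
        then show ?thesis
          using * by (simp add: mpoly_ring_def keys_nat_add)
      qed
      then show ?thesis
        by (simp add: mpoly_ring_def)
    qed
  qed (use uminus in \<open>auto simp: mpoly_ring_def algebra_simps\<close>)
qed

definition mpoly_smult :: "'k::field \<Rightarrow> 'k mpoly \<Rightarrow> 'k mpoly" where
  "mpoly_smult c p = Poly_Mapping.map ((*) c) p"

lemma lookup_mpoly_smult: "Poly_Mapping.lookup (mpoly_smult c p) m = c * Poly_Mapping.lookup p m"
  by (simp add: mpoly_smult_def Poly_Mapping.map.rep_eq when_def)

lemma vector_space_mpoly_smult: "vector_space mpoly_smult"
  by unfold_locales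
    (auto intro!: poly_mapping_eqI simp: lookup_mpoly_smult lookup_add algebra_simps)


section \<open>The standard grading\<close>

definition total_degree :: "(nat \<Rightarrow>\<^sub>0 nat) \<Rightarrow> nat" where
  "total_degree m = (\<Sum>i\<in>Poly_Mapping.keys m. Poly_Mapping.lookup m i)"

text \<open>As usual, \<open>0\<close> is homogeneous of every degree.\<close>

definition homogeneous :: "nat \<Rightarrow> 'k::zero mpoly \<Rightarrow> bool" where
  "homogeneous d p \<longleftrightarrow> (\<forall>m\<in>Poly_Mapping.keys p. total_degree m = d)"

definition graded_part :: "nat \<Rightarrow> 'k::zero mpoly set \<Rightarrow> 'k mpoly set" where
  "graded_part d I = {p \<in> I. homogeneous d p}"

definition homogeneous_component :: "nat \<Rightarrow> 'k::comm_monoid_add mpoly \<Rightarrow> 'k mpoly" where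
  "homogeneous_component d p =
    (\<Sum>m\<in>{m \<in> Poly_Mapping.keys p. total_degree m = d}.
       Poly_Mapping.single m (Poly_Mapping.lookup p m))"

definition homogeneous_ideal :: "nat \<Rightarrow> 'k::comm_ring_1 mpoly set \<Rightarrow> bool" where
  "homogeneous_ideal n I \<longleftrightarrow>
    ideal I (mpoly_ring n) \<and> (\<forall>p\<in>I. \<forall>d. homogeneous_component d p \<in> I)"

definition nondegenerate :: "'k::zero mpoly set \<Rightarrow> bool" where
  "nondegenerate I \<longleftrightarrow> (\<forall>l\<in>I. homogeneous 1 l \<longrightarrow> l = 0)"


section \<open>Height\<close>

text \<open>
  The height of a prime ideal \<open>P\<close> is the supremum of the lengths \<open>m\<close> of chains of prime ideals
  \<open>Q 0 \<subset> Q 1 \<subset> \<dots> \<subset> Q m = P\<close>.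
\<close>

definition height :: "('a, 'b) ring_scheme \<Rightarrow> 'a set \<Rightarrow> enat" where
  "height R P =
    (SUP m \<in> {m. \<exists>Q :: nat \<Rightarrow> 'a set.
        (\<forall>i\<le>m. primeideal (Q i) R) \<and> (\<forall>i<m. Q i \<subset> Q (Suc i)) \<and> Q m = P}. enat m)"

end

theory Submission
  imports Defs
begin

text \<open>
  Let \<open>R = S/P\<close>. The inequality says that the products of two variables span a large space in \<open>R\<close>,
  and it is proved by exhibiting enough independent quadrics modulo \<open>P\<close>, in the spirit of Freiman's lower
  bound for the size of a sumset.

  Order the variables and contract \<open>P\<close> to the ring in the first \<open>i\<close> of them. The extensions of these
  contractions to \<open>S\<close> are primes that increase from \<open>0\<close> to \<open>P\<close>, and they grow strictly exactly when the
  new variable is algebraic modulo \<open>P\<close> over the earlier ones. By the definition of height this happens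
  \<open>g \<le> h\<close> times, so a set \<open>X\<close> of \<open>n - g\<close> variables is algebraically independent modulo \<open>P\<close>
  (\<open>exists_independent_variables\<close>).

  The \<open>k[X]\<close>-submodule of \<open>R\<close> generated by \<open>1\<close> and all variables is torsion-free of finite rank. One
  \<open>D \<in> k[X]\<close> outside \<open>P\<close> multiplies it into a free module with basis \<open>1\<close> and some of the variables
  (\<open>exists_common_denominator\<close>). Elements of this free module lift uniquely to polynomials in \<open>S\<close> of
  degree at most one in the variables outside \<open>X\<close>, and therefore have leading monomials that are
  additive under multiplication by the \<open>x\<^sub>i\<close> with \<open>i \<in> X\<close>. No linear form lies in \<open>P\<close>, so the lifts of
  \<open>D * w\<close>, for \<open>w\<close> linear, have at least \<open>n\<close> leading exponents; write \<open>A\<close> for their set. Among them are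
  \<open>\<mu> + e\<^sub>i\<close> for \<open>i \<in> X\<close>, where \<open>\<mu>\<close> is the leading exponent of \<open>D\<close>
  (\<open>leading_monomials_of_linear_forms\<close>).

  Every sum \<open>e\<^sub>i + a\<close> with \<open>i \<in> X\<close> and \<open>a \<in> A\<close> is the leading exponent of the lift of \<open>D * x\<^sub>i * w\<close> for
  some linear \<open>w\<close>. Hence there are at least as many quadrics independent modulo \<open>P\<close> as there are such
  sums (\<open>independent_Un_leads\<close>). Two of these sums coincide only rarely. Besides the sums
  \<open>\<mu> + e\<^sub>i + e\<^sub>j\<close>, which correspond to the products of two variables in \<open>X\<close>, each of \<open>g\<close> further elements of \<open>A\<close>
  contributes \<open>card X\<close> sums, with at most \<open>g\<^sup>2\<close> coincidences in total (\<open>card_sumset_ge\<close>). All products of two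
  variables number at most those from \<open>X\<close>, plus \<open>g * card X\<close>, plus \<open>g\<^sup>2\<close>. Comparing the two counts
  gives \<open>dim P\<^sub>2 \<le> 2 * g\<^sup>2 \<le> 2 * h\<^sup>2\<close>.
\<close>

section \<open>Polynomials with prescribed support\<close>

abbreviation "lookup \<equiv> Poly_Mapping.lookup"
abbreviation "keys \<equiv> Poly_Mapping.keys"
abbreviation "single \<equiv> Poly_Mapping.single"

global_interpretation mp: vector_space mpoly_smult
  by (rule vector_space_mpoly_smult)

definition supported_on :: "(nat \<Rightarrow>\<^sub>0 nat) set \<Rightarrow> 'k::zero mpoly set" where
  "supported_on M = {p. keys p \<subseteq> M}"

definition monomials_in :: "nat set \<Rightarrow> (nat \<Rightarrow>\<^sub>0 nat) set" where
  "monomials_in V = {m. keys m \<subseteq> V}"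

abbreviation pvar :: "nat \<Rightarrow> 'k::zero_neq_one mpoly" where
  "pvar i \<equiv> single (single i 1) 1"

lemma carrier_mpoly_ring: "carrier (mpoly_ring n) = supported_on (monomials_in {..<n})"
  by (auto simp: mpoly_ring_def supported_on_def monomials_in_def)

lemma mpoly_ring_simps [simp]:
  "monoid.mult (mpoly_ring n) = (*)" "monoid.one (mpoly_ring n) = 1"
  "ring.zero (mpoly_ring n) = 0" "ring.add (mpoly_ring n) = (+)"
  by (simp_all add: mpoly_ring_def)

lemma keys_exponent_add: "keys (a + b) = keys a \<union> keys b" for a b :: "nat \<Rightarrow>\<^sub>0 nat"
  by (auto simp: in_keys_iff lookup_add)

lemma monomials_in_add_iff [simp]:
  "a + b \<in> monomials_in V \<longleftrightarrow> a \<in> monomials_in V \<and> b \<in> monomials_in V"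
  by (simp add: monomials_in_def keys_exponent_add)

lemma supported_on_mult:
  assumes "p \<in> supported_on A" "q \<in> supported_on B" "\<And>a b. a \<in> A \<Longrightarrow> b \<in> B \<Longrightarrow> a + b \<in> C"
  shows "p * q \<in> supported_on C"
  using keys_mult[of p q] assms by (fastforce simp: supported_on_def)

lemma mpoly_smult_conv_mult: "mpoly_smult c p = single 0 c * p"
  by (simp add: mpoly_smult_def mult_map_scale_conv_mult)

lemma subspace_supported_on: "mp.subspace (supported_on M)"
proof (rule mp.subspaceI)
  show "p + q \<in> supported_on M" if "p \<in> supported_on M" "q \<in> supported_on M" for p q :: "'a mpoly"
    using that keys_add[of p q] by (auto simp: supported_on_def)
  show "mpoly_smult c p \<in> supported_on M" if "p \<in> supported_on M" for c and p :: "'a mpoly"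
    using that by (auto simp: supported_on_def in_keys_iff lookup_mpoly_smult)
qed (simp add: supported_on_def)

lemma mpoly_eq_sum_single: "p = (\<Sum>m\<in>keys p. single m (lookup p m))" for p :: "'k::comm_monoid_add mpoly"
  by (rule poly_mapping_eqI)
    (auto simp: lookup_sum lookup_single when_def sum.delta in_keys_iff)

lemma mpoly_add_induct [case_names zero single add]:
  fixes p :: "'k::comm_monoid_add mpoly"
  assumes "Q 0" "\<And>m c. Q (single m c)" "\<And>p q. Q p \<Longrightarrow> Q q \<Longrightarrow> Q (p + q)"
  shows "Q p"
proof -
  have "Q (\<Sum>m\<in>M. single m (lookup p m))" if "finite M" for M
    using that by (induction M) (auto intro: assms)
  then have "Q (\<Sum>m\<in>keys p. single m (lookup p m))"
    by simp
  also have "(\<Sum>m\<in>keys p. single m (lookup p m)) = p"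
    by (rule mpoly_eq_sum_single[symmetric])
  finally show ?thesis .
qed

lemma supported_on_eq_span:
  fixes M :: "(nat \<Rightarrow>\<^sub>0 nat) set"
  shows "(supported_on M :: 'k::field mpoly set) = mp.span ((\<lambda>m. single m 1) ` M)"
proof
  show "mp.span ((\<lambda>m. single m 1) ` M) \<subseteq> (supported_on M :: 'k mpoly set)"
    by (intro mp.span_minimal subspace_supported_on) (auto simp: supported_on_def)
  show "(supported_on M :: 'k mpoly set) \<subseteq> mp.span ((\<lambda>m. single m 1) ` M)"
  proof
    fix p :: "'k mpoly"
    assume p: "p \<in> supported_on M"
    have "single m c = mpoly_smult c (single m 1)" for m :: "nat \<Rightarrow>\<^sub>0 nat" and c :: 'k
      by (auto intro!: poly_mapping_eqI simp: lookup_mpoly_smult lookup_single when_def)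
    then have "single m (lookup p m) \<in> mp.span ((\<lambda>m. single m 1) ` M)" if "m \<in> keys p" for m
      using p that by (metis (mono_tags) imageI in_mono mem_Collect_eq mp.span_base mp.span_scale supported_on_def)
    then have "(\<Sum>m\<in>keys p. single m (lookup p m)) \<in> mp.span ((\<lambda>m. single m 1) ` M)"
      by (intro mp.span_sum)
    also have "(\<Sum>m\<in>keys p. single m (lookup p m)) = p"
      by (rule mpoly_eq_sum_single[symmetric])
    finally show "p \<in> mp.span ((\<lambda>m. single m 1) ` M)" .
  qed
qed

lemma inj_single_one: "inj (\<lambda>m. single m (1::'k::zero_neq_one))"
  by (rule injI) (metis keys_single singleton_inject zero_neq_one)

lemma independent_monomials: "mp.independent ((\<lambda>m. single m (1::'k::field)) ` M)"
proof -
  have "single m (1::'k) \<notin> supported_on (M - {m})" for m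
    by (simp add: supported_on_def)
  moreover have "(\<lambda>m. single m (1::'k)) ` M - {single m 1} = (\<lambda>m. single m 1) ` (M - {m})" for m
    using image_set_diff[OF inj_single_one[where 'k='k], of M "{m}"] by simp
  ultimately have "single m (1::'k) \<notin> mp.span ((\<lambda>m. single m 1) ` M - {single m 1})" for m
    by (simp flip: supported_on_eq_span)
  then show ?thesis
    unfolding mp.dependent_def by blast
qed

section \<open>Coefficients with respect to one variable\<close>

text \<open>
  The coefficient of \<open>x\<^sub>v\<^sup>e\<close> in \<open>f\<close>, read as a polynomial in \<open>x\<^sub>v\<close> over the ring in the other
  variables.
\<close>

definition vcoef :: "nat \<Rightarrow> nat \<Rightarrow> 'k::zero mpoly \<Rightarrow> 'k mpoly" where
  "vcoef v e f = Abs_poly_mapping (\<lambda>m. lookup f (m + single v e) when lookup m v = 0)"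

lemma lookup_vcoef:
  "lookup (vcoef v e f) m = (if lookup m v = 0 then lookup f (m + single v e) else 0)"
proof -
  have "finite ((\<lambda>m. m + single v e) -` keys f)"
    by (rule finite_vimageI) (auto simp: inj_def)
  then have "finite {m. (lookup f (m + single v e) when lookup m v = 0) \<noteq> 0}"
    by (rule rev_finite_subset) (auto simp: in_keys_iff when_def split: if_splits)
  then show ?thesis
    by (simp add: vcoef_def when_def)
qed

lemma vcoef_zero [simp]: "vcoef v e 0 = 0"
  by (rule poly_mapping_eqI) (simp add: lookup_vcoef)

lemma vcoef_add: "vcoef v e (f + g) = vcoef v e f + vcoef v e g"
  by (rule poly_mapping_eqI) (simp add: lookup_vcoef lookup_add)

lemma minus_single_add: "lookup m v = e \<Longrightarrow> m - single v e + single v e = m" for m :: "nat \<Rightarrow>\<^sub>0 nat"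
  by (rule poly_mapping_eqI) (auto simp: lookup_add lookup_minus lookup_single when_def)

lemma vcoef_single:
  "vcoef v e (single m c) = (if lookup m v = e then single (m - single v e) c else 0)"
proof (rule poly_mapping_eqI)
  fix k
  have "lookup k v = 0 \<and> m = k + single v e \<longleftrightarrow> lookup m v = e \<and> m - single v e = k"
    using minus_single_add[of m v e]
    by (auto simp: lookup_add lookup_minus)
  then show "lookup (vcoef v e (single m c)) k =
    lookup (if lookup m v = e then single (m - single v e) c else 0) k"
    by (auto simp: lookup_vcoef lookup_single when_def)
qed

lemma keys_vcoef: "keys (vcoef v e f) = {m. lookup m v = 0 \<and> m + single v e \<in> keys f}"
  by (rule Set.set_eqI) (simp add: in_keys_iff lookup_vcoef)

text \<open>
  Multiplication is the convolution of univariate polynomials. Both sides are biadditive, so it is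
  enough to compare them on two monomials, where a single summand survives.
\<close>

lemma vcoef_mult: "vcoef v e (f * g) = (\<Sum>i\<le>e. vcoef v i f * vcoef v (e - i) g)"
  for f g :: "'k::comm_semiring_0 mpoly"
proof (induction f rule: mpoly_add_induct)
  case zero
  then show ?case by simp
next
  case (add f f')
  then show ?case
    by (simp add: vcoef_add distrib_right sum.distrib)
next
  case (single m c)
  show ?case
  proof (induction g rule: mpoly_add_induct)
    case zero
    then show ?case by simp
  next
    case (add g g')
    then show ?case
      by (simp add: vcoef_add distrib_left sum.distrib)
  next
    case s: (single k d)
    have "vcoef v e (single m c * single k d) =
      (if lookup m v + lookup k v = e then single (m + k - single v e) (c * d) else 0)"
      by (simp add: mult_single vcoef_single lookup_add)
    also have "\<dots> = (if lookup m v \<le> e then vcoef v (lookup m v) (single m c) *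
        vcoef v (e - lookup m v) (single k d) else 0)"
    proof (cases "lookup m v + lookup k v = e")
      case True
      have "m + k - single v e = (m - single v (lookup m v)) + (k - single v (lookup k v))"
        using True
        by (auto intro!: poly_mapping_eqI simp: lookup_add lookup_minus lookup_single when_def)
      then show ?thesis
        using True by (auto simp: vcoef_single mult_single)
    qed (auto simp: vcoef_single)
    also have "\<dots> = (\<Sum>i\<le>e. if i = lookup m v then
        vcoef v i (single m c) * vcoef v (e - i) (single k d) else 0)"
      by simp
    also have "\<dots> = (\<Sum>i\<le>e. vcoef v i (single m c) * vcoef v (e - i) (single k d))"
      by (rule sum.cong) (auto simp: vcoef_single)
    finally show ?case .
  qed
qed

lemma mpoly_eq_sum_vcoef:
  fixes f :: "'k::comm_semiring_1 mpoly"
  assumes "finite E" "\<And>m. m \<in> keys f \<Longrightarrow> lookup m v \<in> E"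
  shows "f = (\<Sum>e\<in>E. vcoef v e f * single (single v e) 1)"
proof -
  have *: "lookup (vcoef v e g * single (single v e) 1) m = (if lookup m v = e then lookup g m else 0)" 
    for e m and g :: "'k mpoly"
  proof (induction g rule: mpoly_add_induct)
    case (single k c)
    then show ?case using minus_single_add[of k v e]
      by (auto simp: vcoef_single mult_single lookup_single when_def)
  qed (auto simp: vcoef_add distrib_right lookup_add)
  show ?thesis
    using assms by (intro poly_mapping_eqI) (auto simp: lookup_sum * in_keys_iff)
qed

section \<open>Independent variables from chains of primes\<close>

lemma
  assumes "ideal I (mpoly_ring n)"
  shows mpoly_ideal_subset: "I \<subseteq> carrier (mpoly_ring n)"
    and mpoly_ideal_zero: "0 \<in> I"
    and mpoly_ideal_add: "p \<in> I \<Longrightarrow> q \<in> I \<Longrightarrow> p + q \<in> I"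
    and mpoly_ideal_mult: "p \<in> carrier (mpoly_ring n) \<Longrightarrow> q \<in> I \<Longrightarrow> p * q \<in> I"
proof -
  interpret ideal I "mpoly_ring n" by fact
  show "I \<subseteq> carrier (mpoly_ring n)" "0 \<in> I" "p \<in> I \<Longrightarrow> q \<in> I \<Longrightarrow> p + q \<in> I"
    "p \<in> carrier (mpoly_ring n) \<Longrightarrow> q \<in> I \<Longrightarrow> p * q \<in> I"
    using a_subset additive_subgroup.zero_closed[OF is_additive_subgroup]
      additive_subgroup.a_closed[OF is_additive_subgroup, of p q] I_l_closed[of q p] by simp_all
qed

lemma const_in_mpoly_ring [simp]: "single 0 c \<in> carrier (mpoly_ring n)"
  by (auto simp: mpoly_ring_def)

lemma mpoly_ideal_uminus: "ideal I (mpoly_ring n) \<Longrightarrow> p \<in> I \<Longrightarrow> - p \<in> I"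
  using mpoly_ideal_mult[OF _ const_in_mpoly_ring, of I n p "-1"] by (simp add: single_uminus)

lemma mpoly_ideal_diff: "ideal I (mpoly_ring n) \<Longrightarrow> p \<in> I \<Longrightarrow> q \<in> I \<Longrightarrow> p - q \<in> I"
  using mpoly_ideal_add[of I n p "- q"] mpoly_ideal_uminus[of I n q] by simp

lemma mpoly_ideal_sum:
  assumes "ideal I (mpoly_ring n)" "\<And>i. i \<in> A \<Longrightarrow> f i \<in> I"
  shows "sum f A \<in> I"
  using assms(2)
  by (induction A rule: infinite_finite_induct)
    (auto intro: mpoly_ideal_zero[OF assms(1)] mpoly_ideal_add[OF assms(1)])

lemma mpoly_primeideal_mult_iff:
  assumes "primeideal I (mpoly_ring n)" "p \<in> carrier (mpoly_ring n)" "q \<in> carrier (mpoly_ring n)"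
  shows "p * q \<in> I \<longleftrightarrow> p \<in> I \<or> q \<in> I"
  using primeideal.I_prime[OF assms(1), of p q] assms mpoly_ideal_mult[of I n p q]
    mpoly_ideal_mult[of I n q p] primeideal.axioms(1)[OF assms(1)] by (auto simp: mult.commute)

lemma mpoly_primeideal_one_notin:
  assumes "primeideal I (mpoly_ring n)"
  shows "1 \<notin> I"
proof
  assume "1 \<in> I"
  then have "p \<in> I" if "p \<in> carrier (mpoly_ring n)" for p
    using mpoly_ideal_mult[OF primeideal.axioms(1)[OF assms] that] by fastforce
  then show False
    using primeideal.I_notcarr[OF assms] mpoly_ideal_subset[OF primeideal.axioms(1)[OF assms]]
    by auto
qed

lemma mpoly_primeidealI:
  assumes "I \<subseteq> carrier (mpoly_ring n)" "0 \<in> I" "1 \<notin> I"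
    and "\<And>p q. p \<in> I \<Longrightarrow> q \<in> I \<Longrightarrow> p + q \<in> I"
    and mult: "\<And>p q. p \<in> carrier (mpoly_ring n) \<Longrightarrow> q \<in> I \<Longrightarrow> p * q \<in> I"
    and "\<And>p q. p \<in> carrier (mpoly_ring n) \<Longrightarrow> q \<in> carrier (mpoly_ring n) \<Longrightarrow>
      p * q \<in> I \<Longrightarrow> p \<in> I \<or> q \<in> I"
  shows "primeideal I (mpoly_ring n)"
proof (rule primeidealI2)
  interpret cring "mpoly_ring n"
    by (rule cring_mpoly_ring)
  show "cring (mpoly_ring n)"
    by (rule cring_mpoly_ring)
  show "additive_subgroup I (mpoly_ring n)"
  proof (intro additive_subgroupI subgroup.intro)
    fix p assume p: "p \<in> I"
    have "- p \<in> I" 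
      using mult[OF const_in_mpoly_ring p, of "-1"] by (simp add: single_uminus)
    moreover have "\<ominus>\<^bsub>mpoly_ring n\<^esub> p = - p"
      using p \<open>- p \<in> I\<close> assms(1) by (intro minus_equality) auto
    ultimately show "inv\<^bsub>add_monoid (mpoly_ring n)\<^esub> p \<in> I"
      by (simp add: a_inv_def)
  qed (use assms in auto)
  show "carrier (mpoly_ring n) \<noteq> I"
    using one_closed assms(3) by auto
  show "a \<otimes>\<^bsub>mpoly_ring n\<^esub> x \<in> I" if "a \<in> I" "x \<in> carrier (mpoly_ring n)" for a x
    using mult[OF that(2,1)] by (simp add: mult.commute)
qed (use assms in auto)

text \<open>
  If \<open>I\<close> contracts to \<open>J\<close> in the ring without \<open>x\<^sub>v\<close>, this is the extension \<open>J[x\<^sub>v]\<close>.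
\<close>

definition coef_ideal :: "nat \<Rightarrow> nat \<Rightarrow> 'k::comm_ring_1 mpoly set \<Rightarrow> 'k mpoly set" where
  "coef_ideal n v I = {f \<in> carrier (mpoly_ring n). \<forall>e. vcoef v e f \<in> I}"

lemma vcoef_in_mpoly_ring: "f \<in> carrier (mpoly_ring n) \<Longrightarrow> vcoef v e f \<in> carrier (mpoly_ring n)"
  by (force simp: mpoly_ring_def keys_vcoef keys_exponent_add)

text \<open>
  Gauss's argument: if neither factor lies in the ideal, take in each one the highest coefficient
  outside \<open>I\<close>. The coefficient of the product in the sum of these two degrees is their product up to
  elements of \<open>I\<close>, so it is not in \<open>I\<close>.
\<close>

lemma primeideal_coef_ideal:
  fixes I :: "'k::comm_ring_1 mpoly set"
  assumes I: "primeideal I (mpoly_ring n)"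
  shows "primeideal (coef_ideal n v I) (mpoly_ring n)"
proof (rule mpoly_primeidealI)
  interpret cring "mpoly_ring n"
    by (rule cring_mpoly_ring)
  have ideal: "ideal I (mpoly_ring n)"
    using I by (rule primeideal.axioms)
  show "coef_ideal n v I \<subseteq> carrier (mpoly_ring n)"
    by (auto simp: coef_ideal_def)
  show "0 \<in> coef_ideal n v I"
    using zero_closed by (simp add: coef_ideal_def mpoly_ideal_zero[OF ideal])
  have "vcoef v 0 1 = (1 :: 'k mpoly)"
    using vcoef_single[of v 0 0 "1 :: 'k"] by simp
  then have "vcoef v 0 1 \<notin> I"
    using mpoly_primeideal_one_notin[OF I] by simp
  then show "1 \<notin> coef_ideal n v I"
    unfolding coef_ideal_def by blast
  show "p + q \<in> coef_ideal n v I" if "p \<in> coef_ideal n v I" "q \<in> coef_ideal n v I" for p q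
    using that a_closed[of p q] by (auto simp: coef_ideal_def vcoef_add mpoly_ideal_add[OF ideal])
  show "p * q \<in> coef_ideal n v I" if "p \<in> carrier (mpoly_ring n)" "q \<in> coef_ideal n v I" for p q
    using that m_closed[of p q]
    by (auto simp: coef_ideal_def vcoef_mult
        intro!: mpoly_ideal_sum[OF ideal] mpoly_ideal_mult[OF ideal] vcoef_in_mpoly_ring)
  have top: "\<exists>a. vcoef v a f \<notin> I \<and> (\<forall>e>a. vcoef v e f \<in> I)"
    if "f \<in> carrier (mpoly_ring n)" "f \<notin> coef_ideal n v I" for f
  proof -
    define E where "E = {e. vcoef v e f \<notin> I}"
    have "vcoef v e f = 0" if "e \<notin> (\<lambda>m. lookup m v) ` keys f" for e
    proof -
      have "m + single v e \<notin> keys f" if "lookup m v = 0" for m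
      proof
        assume "m + single v e \<in> keys f"
        then have "lookup (m + single v e) v \<in> (\<lambda>m. lookup m v) ` keys f"
          by (rule imageI)
        then show False
          using that \<open>e \<notin> _\<close> by (simp add: lookup_add)
      qed
      then have "keys (vcoef v e f) = {}"
        unfolding keys_vcoef by blast
      then show ?thesis
        by simp
    qed
    then have "E \<subseteq> (\<lambda>m. lookup m v) ` keys f"
      unfolding E_def using mpoly_ideal_zero[OF ideal] by force
    then have "finite E"
      by (rule finite_subset) simp
    moreover have "E \<noteq> {}"
      using that by (auto simp: E_def coef_ideal_def)
    ultimately have "Max E \<in> E" "\<forall>e>Max E. e \<notin> E"
      using Max_in[of E] Max_ge[of E] by (blast, meson not_le)
    then show ?thesis
      unfolding E_def by blast
  qed
  show "f \<in> coef_ideal n v I \<or> g \<in> coef_ideal n v I"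
    if f: "f \<in> carrier (mpoly_ring n)" and g: "g \<in> carrier (mpoly_ring n)"
      and fg: "f * g \<in> coef_ideal n v I" for f g
  proof (rule ccontr)
    assume contr: "\<not> ?thesis"
    obtain a where a: "vcoef v a f \<notin> I" "\<And>e. e > a \<Longrightarrow> vcoef v e f \<in> I"
      using top[OF f] contr by auto
    obtain b where b: "vcoef v b g \<notin> I" "\<And>e. e > b \<Longrightarrow> vcoef v e g \<in> I"
      using top[OF g] contr by auto
    \<comment> \<open>In every other summand one of the two indices exceeds its maximum \<open>a\<close> or \<open>b\<close>.\<close>
    let ?t = "\<lambda>i. vcoef v i f * vcoef v (a + b - i) g"
    have "(\<Sum>i\<in>{..a + b} - {a}. ?t i) \<in> I"
    proof (rule mpoly_ideal_sum[OF ideal])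
      fix i assume "i \<in> {..a + b} - {a}"
      then have "i > a \<or> a + b - i > b"
        by auto
      then show "?t i \<in> I"
        using a(2) b(2) vcoef_in_mpoly_ring[OF f] vcoef_in_mpoly_ring[OF g]
        by (auto simp: mpoly_primeideal_mult_iff[OF I])
    qed
    moreover have "(\<Sum>i\<le>a + b. ?t i) \<in> I"
    proof -
      have "vcoef v (a + b) (f * g) \<in> I"
        using fg unfolding coef_ideal_def by blast
      then show ?thesis
        unfolding vcoef_mult .
    qed
    moreover have "?t a = (\<Sum>i\<le>a + b. ?t i) - (\<Sum>i\<in>{..a + b} - {a}. ?t i)"
      by (simp add: sum.remove[of "{..a + b}" a])
    ultimately have "?t a \<in> I"
      using mpoly_ideal_diff[OF ideal] by presburger
    then show False
      using a(1) b(1) vcoef_in_mpoly_ring[OF f] vcoef_in_mpoly_ring[OF g]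
      by (auto simp: mpoly_primeideal_mult_iff[OF I])
  qed
qed

lemma coef_ideal_subset:
  assumes "ideal I (mpoly_ring n)" "v < n"
  shows "coef_ideal n v I \<subseteq> I"
proof
  fix f assume f: "f \<in> coef_ideal n v I"
  have "vcoef v e f * single (single v e) 1 \<in> I" for e
    using f mpoly_ideal_mult[OF assms(1), of "single (single v e) 1" "vcoef v e f"] assms(2)
    by (auto simp: coef_ideal_def mpoly_ring_def mult.commute split: if_splits)
  then have "(\<Sum>e\<in>(\<lambda>m. lookup m v) ` keys f. vcoef v e f * single (single v e) 1) \<in> I"
    by (intro mpoly_ideal_sum[OF assms(1)])
  also have "(\<Sum>e\<in>(\<lambda>m. lookup m v) ` keys f. vcoef v e f * single (single v e) 1) = f"
    by (rule mpoly_eq_sum_vcoef[symmetric]) auto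
  finally show "f \<in> I" .
qed

lemma mem_coef_ideal_if_var_absent:
  assumes "ideal I (mpoly_ring n)" "f \<in> I" "f \<in> supported_on (monomials_in V)" "v \<notin> V"
  shows "f \<in> coef_ideal n v I"
proof -
  have no_v: "lookup m v = 0" if "m \<in> keys f" for m
    using that assms(3,4) by (auto simp: supported_on_def monomials_in_def simp flip: not_in_keys_iff_lookup_eq_zero)
  have "vcoef v e f = (if e = 0 then f else 0)" for e
  proof (rule poly_mapping_eqI)
    fix m
    show "lookup (vcoef v e f) m = lookup (if e = 0 then f else 0) m"
      using no_v[of m] no_v[of "m + single v e"]
      by (cases "e = 0"; cases "lookup m v = 0")
        (auto simp: lookup_vcoef lookup_add simp flip: not_in_keys_iff_lookup_eq_zero)
  qed
  then show ?thesis
    using assms mpoly_ideal_subset[OF assms(1)] by (auto simp: coef_ideal_def mpoly_ideal_zero[OF assms(1)])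
qed

text \<open>
  The variables are removed from the last one downwards, so after \<open>k \<le> n\<close> steps the ideal is the
  extension of the contraction of \<open>P\<close> to the first \<open>n - k\<close> variables.
\<close>

primrec iterated_coef_ideal :: "nat \<Rightarrow> 'k::comm_ring_1 mpoly set \<Rightarrow> nat \<Rightarrow> 'k mpoly set" where
  "iterated_coef_ideal n P 0 = P"
| "iterated_coef_ideal n P (Suc k) = coef_ideal n (n - Suc k) (iterated_coef_ideal n P k)"

lemma primeideal_iterated_coef_ideal:
  "primeideal P (mpoly_ring n) \<Longrightarrow> primeideal (iterated_coef_ideal n P k) (mpoly_ring n)"
  by (induction k) (auto intro: primeideal_coef_ideal)

text \<open>
  The ideals decrease with \<open>k\<close>; dropping the repetitions leaves a strict chain of primes that ends
  in \<open>P\<close>, with one inclusion for every step at which the ideal changes.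
\<close>

lemma iterated_coef_ideal_chain:
  assumes P: "primeideal P (mpoly_ring n)" and "k \<le> n"
  shows "\<exists>C. (\<forall>i. primeideal (C i) (mpoly_ring n)) \<and> C 0 = iterated_coef_ideal n P k \<and>
    (\<forall>i<card {j. j < k \<and> iterated_coef_ideal n P (Suc j) \<noteq> iterated_coef_ideal n P j}. C i \<subset> C (Suc i)) \<and>
    C (card {j. j < k \<and> iterated_coef_ideal n P (Suc j) \<noteq> iterated_coef_ideal n P j}) = P"
  using \<open>k \<le> n\<close>
proof (induction k)
  case 0
  then show ?case
    using P by (intro exI[of _ "\<lambda>_. P"]) auto
next
  case (Suc k)
  let ?T = "iterated_coef_ideal n P"
  let ?J = "\<lambda>k. {j. j < k \<and> ?T (Suc j) \<noteq> ?T j}"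
  obtain C where C: "\<forall>i. primeideal (C i) (mpoly_ring n)" "C 0 = ?T k"
    "\<forall>i<card (?J k). C i \<subset> C (Suc i)" "C (card (?J k)) = P"
    using Suc by auto
  show ?case
  proof (cases "?T (Suc k) = ?T k")
    case True
    then have "?J (Suc k) = ?J k"
      by (auto simp: less_Suc_eq)
    then show ?thesis
      using C True by (intro exI[of _ C]) simp
  next
    case False
    then have "?J (Suc k) = insert k (?J k)"
      by (auto simp: less_Suc_eq)
    then have card: "card (?J (Suc k)) = Suc (card (?J k))"
      by simp
    have "?T (Suc k) \<subset> ?T k"
      using coef_ideal_subset[OF primeideal.axioms(1)[OF primeideal_iterated_coef_ideal[OF P]], of "n - Suc k" k]
        False Suc.prems by auto
    then show ?thesis
      using C primeideal_iterated_coef_ideal[OF P, of "Suc k"] unfolding card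
      by (intro exI[of _ "case_nat (?T (Suc k)) C"]) (auto split: nat.split simp: less_Suc_eq_0_disj)
  qed
qed

lemma chain_length_le_height:
  assumes "\<forall>i\<le>m. primeideal (Q i) R" "\<forall>i<m. Q i \<subset> Q (Suc i)" "Q m = P" "height R P = enat h"
  shows "m \<le> h"
proof -
  have "enat m \<le> height R P"
    unfolding height_def using assms(1-3) by (intro SUP_upper) blast
  then show ?thesis
    using assms(4) by simp
qed

text \<open>
  The steps of the preceding chain at which the ideal changes number at most \<open>h\<close>. The step that
  removes \<open>x\<^sub>v\<close> leaves the ideal unchanged exactly when \<open>x\<^sub>v\<close> is transcendental modulo \<open>P\<close> over the
  variables before it. The set \<open>X\<close> of these variables is therefore algebraically independent modulo
  \<open>P\<close>, and at most \<open>h\<close> variables lie outside it.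
\<close>

lemma exists_independent_variables:
  fixes P :: "'k::field mpoly set"
  assumes P: "primeideal P (mpoly_ring n)" and height: "height (mpoly_ring n) P = enat h"
  obtains X where "X \<subseteq> {..<n}" "card ({..<n} - X) \<le> h"
    "P \<inter> supported_on (monomials_in X) \<subseteq> {0}"
proof -
  let ?T = "iterated_coef_ideal n P"
  define X where "X = {v. v < n \<and> ?T (n - v) = ?T (n - Suc v)}"
  have X_subset: "X \<subseteq> {..<n}"
    by (auto simp: X_def)
  have ideal: "ideal (?T k) (mpoly_ring n)" for k
    using primeideal_iterated_coef_ideal[OF P] by (rule primeideal.axioms)
  have card_X: "card ({..<n} - X) \<le> h"
  proof -
    let ?J = "{j. j < n \<and> ?T (Suc j) \<noteq> ?T j}"
    have "v \<in> (\<lambda>j. n - Suc j) ` ?J" if "v \<in> {..<n} - X" for v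
    proof (rule image_eqI)
      have "Suc (n - Suc v) = n - v" "n - Suc v < n"
        using that by auto
      moreover have "?T (n - v) \<noteq> ?T (n - Suc v)"
        using that unfolding X_def by blast
      ultimately show "n - Suc v \<in> ?J"
        by (metis (mono_tags, lifting) mem_Collect_eq)
      show "v = n - Suc (n - Suc v)"
        using that by simp
    qed
    then have "card ({..<n} - X) \<le> card ?J"
      by (intro surj_card_le[of ?J _ "\<lambda>j. n - Suc j"]) auto
    also have "\<dots> \<le> h"
    proof -
      obtain C where "\<forall>i. primeideal (C i) (mpoly_ring n)" "\<forall>i<card ?J. C i \<subset> C (Suc i)" "C (card ?J) = P"
        using iterated_coef_ideal_chain[OF P order_refl] by blast
      then show ?thesis
        by (intro chain_length_le_height[OF _ _ _ height, of _ C]) auto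
    qed
    finally show ?thesis .
  qed
  \<comment> \<open>For \<open>i \<in> X\<close>, membership of \<open>f\<close> passes to its coefficients with respect to \<open>x\<^sub>i\<close>, which only
    involve earlier variables.\<close>
  have "f = 0" if "i \<le> n" "f \<in> ?T (n - i)" "f \<in> supported_on (monomials_in (X \<inter> {..<i}))" for i f
    using that
  proof (induction i arbitrary: f)
    case 0
    have P0: "1 \<notin> ?T n"
      by (rule mpoly_primeideal_one_notin[OF primeideal_iterated_coef_ideal[OF P]])
    have "keys f \<subseteq> {0}"
      using 0 by (auto simp: supported_on_def monomials_in_def)
    then have f: "single 0 (lookup f 0) = f"
      by (intro poly_mapping_eqI) (auto simp: lookup_single when_def in_keys_iff)
    have "lookup f 0 = 0"
    proof (rule ccontr)
      assume "lookup f 0 \<noteq> 0"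
      then have "single 0 (1 / lookup f 0) * single 0 (lookup f 0) = (1 :: 'k mpoly)"
        by (simp add: mult_single)
      then have "single 0 (1 / lookup f 0) * f = 1"
        unfolding f .
      then show False
        using 0 P0 mpoly_ideal_mult[OF ideal const_in_mpoly_ring, of f n "1 / lookup f 0"] by simp
    qed
    then show ?case
      using f by simp
  next
    case (Suc i)
    have "n - i = Suc (n - Suc i)" "n - Suc (n - Suc i) = i"
      using Suc.prems by auto
    then have T: "?T (n - i) = coef_ideal n i (?T (n - Suc i))"
      by (metis iterated_coef_ideal.simps(2))
    show ?case
    proof (cases "i \<in> X")
      case True
      have vcoef_0: "vcoef i e f = 0" for e
      proof (rule Suc.IH)
        show supp: "vcoef i e f \<in> supported_on (monomials_in (X \<inter> {..<i}))"
          unfolding supported_on_def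
        proof safe
          fix m assume m: "m \<in> keys (vcoef i e f)"
          have "m + single i e \<in> monomials_in (X \<inter> {..<Suc i})"
            using m Suc.prems(3) unfolding keys_vcoef supported_on_def by blast
          then have "keys m \<subseteq> X \<inter> {..<Suc i}"
            by (simp add: monomials_in_def keys_exponent_add)
          moreover have "i \<notin> keys m"
            using m by (simp add: keys_vcoef in_keys_iff)
          ultimately show "m \<in> monomials_in (X \<inter> {..<i})"
            unfolding monomials_in_def by (auto simp: less_Suc_eq)
        qed
        have "vcoef i e f \<in> ?T (n - Suc i)"
          using Suc.prems True T by (auto simp: X_def coef_ideal_def)
        then show "vcoef i e f \<in> ?T (n - i)"
          unfolding T using supp by (intro mem_coef_ideal_if_var_absent[OF ideal]) auto
      qed (use Suc.prems in simp)
      have "f = (\<Sum>e\<in>(\<lambda>m. lookup m i) ` keys f. vcoef i e f * single (single i e) 1)"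
        by (rule mpoly_eq_sum_vcoef) auto
      also have "\<dots> = 0"
        by (simp add: vcoef_0)
      finally show ?thesis .
    next
      case False
      have "X \<inter> {..<Suc i} = X \<inter> {..<i}"
        using False by (auto simp: less_Suc_eq)
      then have supp: "f \<in> supported_on (monomials_in (X \<inter> {..<i}))"
        using Suc.prems by simp
      have "f \<in> ?T (n - i)"
        unfolding T using supp Suc.prems by (intro mem_coef_ideal_if_var_absent[OF ideal]) auto
      then show ?thesis
        using Suc.IH supp Suc.prems by simp
    qed
  qed
  from this[of n] have "P \<inter> supported_on (monomials_in X) \<subseteq> {0}"
    using Int_absorb2[OF X_subset] by auto
  then show ?thesis
    using X_subset card_X by (rule that[rotated 2])
qed

section \<open>A common denominator\<close>

text \<open>
  The polynomials supported on these monomials form the \<open>k[X]\<close>-module spanned by \<open>1\<close> and the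
  variables in \<open>Z\<close>.
\<close>

definition affine_monomials :: "nat set \<Rightarrow> nat set \<Rightarrow> (nat \<Rightarrow>\<^sub>0 nat) set" where
  "affine_monomials X Z = monomials_in X \<union> {a + single z 1 | a z. a \<in> monomials_in X \<and> z \<in> Z}"

lemma affine_monomials_mono: "Z \<subseteq> Z' \<Longrightarrow> affine_monomials X Z \<subseteq> affine_monomials X Z'"
  by (auto simp: affine_monomials_def)

lemma supported_on_mono: "p \<in> supported_on M \<Longrightarrow> M \<subseteq> N \<Longrightarrow> p \<in> supported_on N"
  by (auto simp: supported_on_def)

lemma supported_on_affine_mult:
  assumes "p \<in> supported_on (monomials_in X)" "u \<in> supported_on (affine_monomials X Z)"
  shows "p * u \<in> supported_on (affine_monomials X Z)"
  using assms
proof (rule supported_on_mult)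
  fix a b assume a: "a \<in> monomials_in X" and b: "b \<in> affine_monomials X Z"
  show "a + b \<in> affine_monomials X Z"
  proof (cases "b \<in> monomials_in X")
    case True
    then show ?thesis
      using a by (simp add: affine_monomials_def)
  next
    case False
    then obtain c z where "b = c + single z 1" "c \<in> monomials_in X" "z \<in> Z"
      using b unfolding affine_monomials_def by blast
    then have "a + b = (a + c) + single z 1" "a + c \<in> monomials_in X"
      using a by (simp_all add: add.assoc)
    then show ?thesis
      using \<open>z \<in> Z\<close> unfolding affine_monomials_def by blast
  qed
qed

lemma lookup_eq_0_if_in_monomials_in: "m \<in> monomials_in X \<Longrightarrow> v \<notin> X \<Longrightarrow> lookup m v = 0"
  unfolding monomials_in_def by (metis in_keys_iff in_mono mem_Collect_eq)

lemma affine_decomposition: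
  fixes f :: "'k::comm_ring_1 mpoly"
  assumes f: "f \<in> supported_on (affine_monomials X (insert y Z))" and y: "y \<notin> X" "y \<notin> Z"
  obtains p u where "p \<in> supported_on (monomials_in X)" "u \<in> supported_on (affine_monomials X Z)"
    "f = p * pvar y + u"
proof -
  have cases: "(lookup m y = 0 \<and> m \<in> affine_monomials X Z) \<or>
      (lookup m y = 1 \<and> (\<exists>a\<in>monomials_in X. m = a + single y 1))" if "m \<in> keys f" for m
  proof -
    have "m \<in> affine_monomials X (insert y Z)"
      using that f unfolding supported_on_def by blast
    then consider "m \<in> monomials_in X" | a z where "a \<in> monomials_in X" "z \<in> Z" "m = a + single z 1"
      | a where "a \<in> monomials_in X" "m = a + single y 1"
      unfolding affine_monomials_def by blast
    then show ?thesis
    proof cases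
      case 1
      then show ?thesis
        using lookup_eq_0_if_in_monomials_in y(1) by (simp add: affine_monomials_def)
    next
      case 2
      then have "lookup m y = 0" "m \<in> affine_monomials X Z"
        using lookup_eq_0_if_in_monomials_in[OF 2(1) y(1)] y(2)
        by (auto simp: lookup_add lookup_single affine_monomials_def when_def)
      then show ?thesis by blast
    next
      case 3
      then show ?thesis
        using lookup_eq_0_if_in_monomials_in[OF 3(1) y(1)] by (auto simp: lookup_add)
    qed
  qed
  show ?thesis
  proof (rule that)
    show "vcoef y 1 f \<in> supported_on (monomials_in X)"
      unfolding supported_on_def
    proof safe
      fix m assume m: "m \<in> keys (vcoef y 1 f)"
      then have "lookup (m + single y 1) y = 1" "m + single y 1 \<in> keys f"
        by (simp_all add: keys_vcoef lookup_add)
      then obtain a where "a \<in> monomials_in X" "m + single y 1 = a + single y 1"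
        using cases[of "m + single y 1"] by auto
      then show "m \<in> monomials_in X"
        by simp
    qed
    show "vcoef y 0 f \<in> supported_on (affine_monomials X Z)"
      unfolding supported_on_def
    proof safe
      fix m assume "m \<in> keys (vcoef y 0 f)"
      then have "lookup m y = 0" "m \<in> keys f"
        by (simp_all add: keys_vcoef)
      then show "m \<in> affine_monomials X Z"
        using cases[of m] by auto
    qed
    have "f = (\<Sum>e\<in>{0, 1}. vcoef y e f * single (single y e) 1)"
      by (rule mpoly_eq_sum_vcoef) (use cases in auto)
    also have "\<dots> = vcoef y 1 f * pvar y + vcoef y 0 f"
      by (simp add: add.commute)
    finally show "f = vcoef y 1 f * pvar y + vcoef y 0 f" .
  qed
qed

text \<open>
  Over the fraction field of \<open>k[X]\<close>, the images of \<open>1\<close> and of the variables in \<open>Y\<close> modulo \<open>P\<close> span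
  a finite-dimensional space, and \<open>Z\<close> completes \<open>1\<close> to a basis of it chosen among the variables. Clearing
  denominators places \<open>D * y\<close>, for each \<open>y\<close> in \<open>Y\<close>, in the free \<open>k[X]\<close>-module on this basis. Because
  the polynomials in this module meet \<open>P\<close> only in \<open>0\<close>, a residue class has at most one representative
  there, and leading monomials become meaningful modulo \<open>P\<close>.
\<close>

lemma exists_common_denominator:
  fixes P :: "'k::field mpoly set"
  assumes P: "primeideal P (mpoly_ring n)" and X: "X \<subseteq> {..<n}"
    and PX: "P \<inter> supported_on (monomials_in X) \<subseteq> {0}"
    and "finite Y" "Y \<subseteq> {..<n} - X"
  shows "\<exists>Z\<subseteq>Y. \<exists>D\<in>supported_on (monomials_in X) - P. P \<inter> supported_on (affine_monomials X Z) \<subseteq> {0} \<and>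
    (\<forall>y\<in>Y. \<exists>u\<in>supported_on (affine_monomials X Z). D * pvar y - u \<in> P)"
  using assms(4,5)
proof (induction Y rule: finite_induct)
  case empty
  have "1 \<in> supported_on (monomials_in X) - P"
    using mpoly_primeideal_one_notin[OF P] by (simp add: supported_on_def monomials_in_def)
  then show ?case
    using PX by (intro exI[of _ "{}"] conjI bexI[of _ 1]) (simp_all add: affine_monomials_def)
next
  case (insert y Y)
  note ideal = primeideal.axioms(1)[OF P]
  let ?U = "\<lambda>Z. supported_on (affine_monomials X Z) :: 'k mpoly set"
  have y: "y < n" "y \<notin> X"
    using insert.prems by auto
  have pvar_y: "pvar y \<in> carrier (mpoly_ring n)"
    using y by (simp add: mpoly_ring_def)
  have carrier: "p \<in> carrier (mpoly_ring n)" if "p \<in> supported_on (monomials_in X)" for p :: "'k mpoly"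
    unfolding carrier_mpoly_ring using that
    by (rule supported_on_mono) (use X in \<open>auto simp: monomials_in_def\<close>)
  obtain Z D where Z: "Z \<subseteq> Y" and D: "D \<in> supported_on (monomials_in X)" "D \<notin> P"
    and PZ: "P \<inter> ?U Z \<subseteq> {0}" and DY: "\<And>t. t \<in> Y \<Longrightarrow> \<exists>u\<in>?U Z. D * pvar t - u \<in> P"
    using insert.IH insert.prems by auto
  show ?case
  proof (cases "P \<inter> ?U (insert y Z) \<subseteq> {0}")
    case True
    have "\<exists>u\<in>?U (insert y Z). D * pvar t - u \<in> P" if "t \<in> insert y Y" for t
    proof (cases "t = y")
      case True
      have "D * pvar y \<in> ?U (insert y Z)"
        using D(1)
      proof (rule supported_on_mult)
        show "pvar y \<in> supported_on {single y 1}"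
          by (simp add: supported_on_def)
      qed (auto simp: affine_monomials_def)
      then show ?thesis
        using True mpoly_ideal_zero[OF ideal] by (intro bexI[of _ "D * pvar y"]) simp_all
    next
      case False
      then obtain u where "u \<in> ?U Z" "D * pvar t - u \<in> P"
        using DY \<open>t \<in> insert y Y\<close> by blast
      then show ?thesis
        using supported_on_mono[OF _ affine_monomials_mono[of Z "insert y Z"]] by blast
    qed
    then show ?thesis
      using True D Z by (intro exI[of _ "insert y Z"] conjI bexI[of _ D]) auto
  next
    case False
    then obtain f where f: "f \<in> P" "f \<in> ?U (insert y Z)" "f \<noteq> 0"
      by blast
    have "y \<notin> Z"
      using Z insert.hyps by blast
    then obtain p w where p: "p \<in> supported_on (monomials_in X)" and w: "w \<in> ?U Z"
      and f_eq: "f = p * pvar y + w"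
      using affine_decomposition[OF f(2) y(2)] by blast
    have "p \<notin> P"
    proof
      assume "p \<in> P"
      then have "p = 0"
        using PX p by blast
      then have "f \<in> P \<inter> ?U Z"
        using f(1) w f_eq by simp
      then show False
        using PZ f(3) by blast
    qed
    then have "D * p \<in> supported_on (monomials_in X) - P"
      using D p mpoly_primeideal_mult_iff[OF P carrier carrier]
        supported_on_mult[OF D(1) p, of "monomials_in X"] by simp
    moreover have "\<exists>u\<in>?U Z. D * p * pvar t - u \<in> P" if "t \<in> insert y Y" for t
    proof (cases "t = y")
      case True
      have "D * p * pvar y - - (D * w) = D * f"
        by (simp add: f_eq algebra_simps)
      then have "D * p * pvar y - - (D * w) \<in> P"
        using mpoly_ideal_mult[OF ideal carrier[OF D(1)] f(1)] by simp
      then show ?thesis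
        using True supported_on_affine_mult[OF D(1) w] mp.subspace_neg[OF subspace_supported_on] by blast
    next
      case False
      then obtain u where u: "u \<in> ?U Z" "D * pvar t - u \<in> P"
        using DY \<open>t \<in> insert y Y\<close> by blast
      have "D * p * pvar t - p * u = p * (D * pvar t - u)"
        by (simp add: algebra_simps)
      then have "D * p * pvar t - p * u \<in> P"
        using mpoly_ideal_mult[OF ideal carrier[OF p] u(2)] by simp
      then show ?thesis
        using supported_on_affine_mult[OF p u(1)] by blast
    qed
    ultimately show ?thesis
      using Z PZ by (intro exI[of _ Z] conjI bexI[of _ "D * p"]) auto
  qed
qed

section \<open>Leading monomials\<close>

definition lead :: "'k::zero mpoly \<Rightarrow> nat \<Rightarrow>\<^sub>0 nat" where
  "lead p = Max (keys p)"

lemma lead_in_keys: "p \<noteq> 0 \<Longrightarrow> lead p \<in> keys p"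
  unfolding lead_def by (rule Max_in) simp_all

lemma le_lead: "m \<in> keys p \<Longrightarrow> m \<le> lead p"
  unfolding lead_def by (rule Max_ge) simp_all

lemma lookup_monomial_times: "lookup (single a 1 * p) (a + m) = lookup p m"
  for p :: "'k::comm_semiring_1 mpoly"
  by (induction p rule: mpoly_add_induct) (simp_all add: mult_single lookup_single when_def distrib_left lookup_add)

lemma keys_monomial_times: "keys (single a 1 * p) = (+) a ` keys p" for p :: "'k::comm_ring_1 mpoly"
proof
  show "keys (single a 1 * p) \<subseteq> (+) a ` keys p"
    using keys_mult[of "single a 1" p] by (auto split: if_splits)
  show "(+) a ` keys p \<subseteq> keys (single a 1 * p)"
    by (auto simp: in_keys_iff lookup_monomial_times)
qed

lemma lead_monomial_times:
  fixes p :: "'k::comm_ring_1 mpoly"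
  assumes "p \<noteq> 0"
  shows "lead (single a 1 * p) = a + lead p" "single a 1 * p \<noteq> 0"
proof -
  show "lead (single a 1 * p) = a + lead p"
    unfolding lead_def keys_monomial_times using assms
    by (intro mono_Max_commute[symmetric]) (auto intro: monoI add_left_mono)
  show "single a 1 * p \<noteq> 0"
    using keys_monomial_times[of a p] assms by force
qed

lemma keys_diff_lead_less:
  fixes p q :: "'k::field mpoly"
  assumes q: "q \<noteq> 0" "lead q = lead p"
    and m: "m \<in> keys (p - mpoly_smult (lookup p (lead p) / lookup q (lead p)) q)"
  shows "m < lead p"
proof -
  have "m \<noteq> lead p"
  proof
    assume "m = lead p"
    then show False
      using m lead_in_keys[OF q(1)] q(2) by (simp add: in_keys_iff lookup_minus lookup_mpoly_smult)
  qed
  moreover have "m \<in> keys p \<or> m \<in> keys q"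
    using m by (auto simp: in_keys_iff lookup_minus lookup_mpoly_smult)
  ultimately show ?thesis
    using le_lead[of m p] le_lead[of m q] q(2) by fastforce
qed

text \<open>
  One vector for each leading monomial of \<open>N\<close> on \<open>V\<close> suffices to span \<open>V\<close>: subtracting a multiple
  of the one with the same leading monomial lowers the leading monomial of the image, and this stops
  because only the finitely many monomials in \<open>K\<close> occur.
\<close>

lemma card_le_card_leads:
  fixes N :: "'k::field mpoly \<Rightarrow> 'k mpoly"
  assumes V: "mp.subspace V"
    and diff: "\<And>v w c. N (v - mpoly_smult c w) = N v - mpoly_smult c (N w)"
    and inj: "\<And>v. v \<in> V \<Longrightarrow> N v = 0 \<Longrightarrow> v = 0"
    and K: "finite K" "\<And>v. v \<in> V \<Longrightarrow> keys (N v) \<subseteq> K"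
    and B: "mp.independent B" "B \<subseteq> V"
  shows "card B \<le> card ((\<lambda>v. lead (N v)) ` (V - {0}))"
proof -
  let ?A = "(\<lambda>v. lead (N v)) ` (V - {0})"
  have "\<forall>a\<in>?A. \<exists>v. v \<in> V - {0} \<and> lead (N v) = a"
    by blast
  then obtain w where w: "\<And>a. a \<in> ?A \<Longrightarrow> w a \<in> V - {0} \<and> lead (N (w a)) = a"
    by metis
  have nz: "N v \<noteq> 0" if "v \<in> V - {0}" for v
    using inj that by blast
  have "?A \<subseteq> K"
    using K(2) lead_in_keys nz by blast
  then have finA: "finite ?A"
    using K(1) by (rule finite_subset)
  have span: "v \<in> mp.span (w ` ?A)" if "v \<in> V - {0}" for v
    using that
  proof (induction "card {k \<in> K. k \<le> lead (N v)}" arbitrary: v rule: less_induct)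
    case less
    define a where "a = lead (N v)"
    define c where "c = lookup (N v) a / lookup (N (w a)) a"
    define v' where "v' = v - mpoly_smult c (w a)"
    have a: "a \<in> ?A"
      using less.prems unfolding a_def by blast
    have v'V: "v' \<in> V"
      unfolding v'_def using V w[OF a] less.prems by (intro mp.subspace_diff mp.subspace_scale) auto
    have Nv': "N v' = N v - mpoly_smult c (N (w a))"
      unfolding v'_def by (rule diff)
    have small: "m < a" if "m \<in> keys (N v')" for m
      using keys_diff_lead_less[of "N (w a)" "N v" m] nz[of "w a"] w[OF a] that
      unfolding Nv' c_def a_def by simp
    have "v' \<in> mp.span (w ` ?A)"
    proof (cases "v' = 0")
      case False
      have lead_in: "lead (N v') \<in> keys (N v')"
        using False v'V nz by (intro lead_in_keys) auto
      have "{k \<in> K. k \<le> lead (N v')} \<subset> {k \<in> K. k \<le> lead (N v)}"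
      proof
        show "{k \<in> K. k \<le> lead (N v')} \<subseteq> {k \<in> K. k \<le> lead (N v)}"
          using small[OF lead_in] by (auto simp: a_def)
        have "a \<in> K"
          using \<open>?A \<subseteq> K\<close> a by blast
        then show "{k \<in> K. k \<le> lead (N v')} \<noteq> {k \<in> K. k \<le> lead (N v)}"
          using small[OF lead_in] unfolding a_def by force
      qed
      then have "card {k \<in> K. k \<le> lead (N v')} < card {k \<in> K. k \<le> lead (N v)}"
        using K(1) by (intro psubset_card_mono) auto
      then show ?thesis
        using less.hyps v'V False by blast
    qed (simp add: mp.span_zero)
    moreover have "mpoly_smult c (w a) \<in> mp.span (w ` ?A)"
      using a by (intro mp.span_scale mp.span_base) blast
    moreover have "v = v' + mpoly_smult c (w a)"
      by (simp add: v'_def)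
    ultimately show ?case
      using mp.span_add by metis
  qed
  then have "B \<subseteq> mp.span (w ` ?A)"
    using B(2) mp.span_zero by blast
  then have "card B \<le> card (w ` ?A)"
    using mp.independent_span_bound[of "w ` ?A" B] finA B(1) by blast
  also have "\<dots> \<le> card ?A"
    using finA by (rule card_image_le)
  finally show ?thesis .
qed

text \<open>
  Elements \<open>q c\<close> whose multiples \<open>D * q c\<close> have representatives in \<open>U\<close> with distinct leading
  monomials are independent modulo \<open>P\<close>. Adding them in increasing order of \<open>c\<close>, everything in
  the span of the earlier ones and \<open>P\<close> has a representative supported below \<open>c\<close>, and representatives
  are unique.
\<close>

lemma independent_Un_leads:
  fixes P B :: "'k::field mpoly set" and q :: "(nat \<Rightarrow>\<^sub>0 nat) \<Rightarrow> 'k mpoly"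
  assumes P: "ideal P (mpoly_ring n)" and D: "D \<in> carrier (mpoly_ring n)"
    and U: "mp.subspace U" "P \<inter> U \<subseteq> {0}"
    and B: "mp.independent B" "B \<subseteq> P" "finite B"
    and "finite C"
    and "\<And>c. c \<in> C \<Longrightarrow> \<exists>u\<in>U. u \<noteq> 0 \<and> lead u = c \<and> D * q c - u \<in> P"
  shows "mp.independent (B \<union> q ` C) \<and> card (B \<union> q ` C) = card B + card C"
  using assms(8,9)
proof (induction C rule: finite_linorder_max_induct)
  case empty
  then show ?case
    using B by simp
next
  case (insert c C)
  let ?T = "{f. \<exists>u\<in>U. D * f - u \<in> P \<and> (\<forall>m\<in>keys u. m < c)}"
  have scale: "mpoly_smult k f \<in> P" if "f \<in> P" for k f
    unfolding mpoly_smult_conv_mult using that by (intro mpoly_ideal_mult[OF P]) simp_all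
  have sub: "mp.subspace ?T"
  proof (rule mp.subspaceI)
    show "0 \<in> ?T"
      using mp.subspace_0[OF U(1)] mpoly_ideal_zero[OF P] by force
    show "f + g \<in> ?T" if fg: "f \<in> ?T" "g \<in> ?T" for f g
    proof -
      obtain u w where u: "u \<in> U" "D * f - u \<in> P" "\<forall>m\<in>keys u. m < c"
        and w: "w \<in> U" "D * g - w \<in> P" "\<forall>m\<in>keys w. m < c"
        using fg by blast
      have "D * (f + g) - (u + w) = (D * f - u) + (D * g - w)"
        by (simp add: algebra_simps)
      then have "D * (f + g) - (u + w) \<in> P"
        using mpoly_ideal_add[OF P u(2) w(2)] by metis
      moreover have "u + w \<in> U"
        using U(1) u(1) w(1) by (rule mp.subspace_add)
      moreover have "\<forall>m\<in>keys (u + w). m < c"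
        using keys_add[of u w] u(3) w(3) by blast
      ultimately show ?thesis by blast
    qed
    show "mpoly_smult k f \<in> ?T" if f: "f \<in> ?T" for k f
    proof -
      obtain u where u: "u \<in> U" "D * f - u \<in> P" "\<forall>m\<in>keys u. m < c"
        using f by blast
      have "D * mpoly_smult k f - mpoly_smult k u = mpoly_smult k (D * f - u)"
        by (simp add: mpoly_smult_conv_mult algebra_simps)
      then have "D * mpoly_smult k f - mpoly_smult k u \<in> P"
        using scale[OF u(2)] by metis
      moreover have "mpoly_smult k u \<in> U"
        using U(1) u(1) by (rule mp.subspace_scale)
      moreover have "\<forall>m\<in>keys (mpoly_smult k u). m < c"
        using u(3) by (auto simp: in_keys_iff lookup_mpoly_smult)
      ultimately show ?thesis by blast
    qed
  qed
  have BT: "B \<subseteq> ?T"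
  proof
    fix b assume "b \<in> B"
    then have "D * b \<in> P"
      using B(2) mpoly_ideal_mult[OF P D] by blast
    then show "b \<in> ?T"
      using mp.subspace_0[OF U(1)] by (auto intro!: bexI[of _ 0])
  qed
  have CT: "q ` C \<subseteq> ?T"
  proof (rule image_subsetI)
    fix c' assume c': "c' \<in> C"
    obtain u where u: "u \<in> U" "lead u = c'" "D * q c' - u \<in> P"
      using insert.prems[of c'] c' by blast
    have "m < c" if "m \<in> keys u" for m
      using le_lead[OF that] u(2) insert.hyps(2) c' by fastforce
    then show "q c' \<in> ?T"
      using u by blast
  qed
  have span: "mp.span (B \<union> q ` C) \<subseteq> ?T"
    using BT CT by (intro mp.span_minimal[OF _ sub]) blast
  have notin: "q c \<notin> mp.span (B \<union> q ` C)"
  proof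
    assume "q c \<in> mp.span (B \<union> q ` C)"
    then obtain u' where u': "u' \<in> U" "D * q c - u' \<in> P" "\<forall>m\<in>keys u'. m < c"
      using span by blast
    obtain u where u: "u \<in> U" "u \<noteq> 0" "lead u = c" "D * q c - u \<in> P"
      using insert.prems[of c] by blast
    have "u - u' = (D * q c - u') - (D * q c - u)"
      by simp
    then have "u - u' \<in> P"
      using mpoly_ideal_diff[OF P u'(2) u(4)] by metis
    moreover have "u - u' \<in> U"
      using U(1) u(1) u'(1) by (rule mp.subspace_diff)
    ultimately have "u = u'"
      using U(2) by auto
    then show False
      using lead_in_keys[OF u(2)] u(3) u'(3) by auto
  qed
  have "mp.independent (B \<union> q ` C) \<and> card (B \<union> q ` C) = card B + card C"
    by (rule insert.IH) (rule insert.prems[OF insertI2])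
  then have IH: "mp.independent (B \<union> q ` C)" "card (B \<union> q ` C) = card B + card C"
    by simp_all
  have "q c \<notin> B \<union> q ` C"
    using notin mp.span_base[of "q c" "B \<union> q ` C"] by argo
  then have "card (insert (q c) (B \<union> q ` C)) = Suc (card B + card C)"
    using IH(2) insert.hyps(1) B(3) by simp
  moreover have "card (insert c C) = Suc (card C)"
    using insert.hyps by (intro card_insert_disjoint) auto
  moreover have "B \<union> q ` insert c C = insert (q c) (B \<union> q ` C)"
    by blast
  ultimately show ?case
    using mp.independent_insertI[OF notin IH(1)] by simp
qed

section \<open>Counting sums of exponent vectors\<close>

lemma lookup_single_if: "lookup (single i e) v = (if i = v then e else 0)"
  by (simp add: lookup_single when_def)

lemma single_add_single_cancel:
  fixes i j p q :: nat
  assumes "single i (1::nat) + single q 1 = single p 1 + single j 1"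
  shows "i = p \<and> q = j \<or> i = j"
proof -
  have "lookup (single i (1::nat) + single q 1) v = lookup (single p (1::nat) + single j 1) v" for v
    using assms by simp
  from this[of i] this[of q] show ?thesis
    by (auto simp: lookup_add lookup_single_if split: if_splits)
qed

text \<open>
  A difference of two distinct unit vectors determines both, so two translates of a set of
  unit vectors share at most one point.
\<close>

lemma card_translates_diff:
  fixes b b' :: "nat \<Rightarrow>\<^sub>0 nat"
  assumes "b \<noteq> b'" "finite X"
  shows "card ((\<lambda>i. single i 1 + b) ` X \<inter> (\<lambda>i. single i 1 + b') ` X) \<le> Suc 0"
proof -
  have "i = j"
    if "single i 1 + b = single p 1 + b'" "single j 1 + b = single q 1 + b'" for i j p q
  proof -
    have "single i 1 + single q 1 + (b + b') = (single i 1 + b) + (single q 1 + b')"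
      by (simp add: ac_simps)
    also have "\<dots> = (single p 1 + b') + (single j 1 + b)"
      using that by simp
    also have "\<dots> = single p 1 + single j 1 + (b + b')"
      by (simp add: ac_simps)
    finally have "single i (1::nat) + single q 1 = single p 1 + single j 1"
      by simp
    then have "i = p \<and> q = j \<or> i = j"
      by (rule single_add_single_cancel)
    moreover have "i \<noteq> p"
      using that(1) assms(1) by auto
    ultimately show ?thesis
      by blast
  qed
  then show ?thesis
    using assms(2) unfolding card_le_Suc0_iff_eq[OF finite_Int[OF disjI1[OF finite_imageI[OF assms(2)]]]]
    by blast
qed

text \<open>
  If \<open>e\<^sub>i + b\<close> and \<open>e\<^sub>j + b\<close> with \<open>i \<noteq> j\<close> both have the form \<open>\<mu> + e\<^sub>p + e\<^sub>q\<close>, then \<open>e\<^sub>i\<close> must be one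
  of the two summands of the first, and cancelling it shows that \<open>b\<close> lies in the excluded set.
\<close>

lemma card_translate_quadratic:
  fixes b \<mu> :: "nat \<Rightarrow>\<^sub>0 nat"
  assumes b: "b \<notin> (\<lambda>i. \<mu> + single i 1) ` X" and "finite X"
  shows "card ((\<lambda>i. single i 1 + b) ` X \<inter> {\<mu> + single i 1 + single j 1 | i j. i \<in> X \<and> j \<in> X}) \<le> Suc 0"
proof -
  have main: "i = j"
    if eq: "single i 1 + b = \<mu> + single p 1 + single q 1" "single j 1 + b = \<mu> + single r 1 + single s 1"
      and X: "p \<in> X" "q \<in> X" for i j p q r s
  proof (rule ccontr)
    assume "i \<noteq> j"
    have "single j 1 + single p 1 + single q 1 + (b + \<mu>) = (single j 1 + b) + (\<mu> + single p 1 + single q 1)"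
      by (simp add: ac_simps)
    also have "\<dots> = (\<mu> + single r 1 + single s 1) + (single i 1 + b)"
      using eq by simp
    also have "\<dots> = single i 1 + single r 1 + single s 1 + (b + \<mu>)"
      by (simp add: ac_simps)
    finally have "single j (1::nat) + single p 1 + single q 1 = single i 1 + single r 1 + single s 1"
      by simp
    then have "lookup (single j (1::nat) + single p 1 + single q 1) i =
        lookup (single i (1::nat) + single r 1 + single s 1) i"
      by simp
    then have "p = i \<or> q = i"
      using \<open>i \<noteq> j\<close> by (auto simp: lookup_add lookup_single_if split: if_splits)
    then have "b = \<mu> + single q 1 \<or> b = \<mu> + single p 1"
    proof
      assume "p = i"
      then have "single i 1 + b = single i 1 + (\<mu> + single q 1)"
        using eq(1) by (simp add: ac_simps)
      then show ?thesis by simp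
    next
      assume "q = i"
      then have "single i 1 + b = single i 1 + (\<mu> + single p 1)"
        using eq(1) by (simp add: ac_simps)
      then show ?thesis by simp
    qed
    then show False
      using b X by blast
  qed
  show ?thesis
    unfolding card_le_Suc0_iff_eq[OF finite_Int[OF disjI1[OF finite_imageI[OF assms(2)]]]]
    using main by blast
qed

text \<open>
  Each new translate of the \<open>card X\<close> unit vectors loses at most one point to \<open>Y0\<close> and at most one
  to each earlier translate, hence at most \<open>card B\<close> points; the total loss is at most the square of
  \<open>card B\<close>.
\<close>

lemma card_sumset_ge:
  fixes \<mu> :: "nat \<Rightarrow>\<^sub>0 nat" and X :: "nat set"
  defines "Y0 \<equiv> {\<mu> + single i 1 + single j 1 | i j. i \<in> X \<and> j \<in> X}"
  assumes X: "finite X" and "finite B" and "B \<inter> (\<lambda>i. \<mu> + single i 1) ` X = {}"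
  shows "card Y0 + card X * card B \<le> card (Y0 \<union> (\<Union>b\<in>B. (\<lambda>i. single i 1 + b) ` X)) + card B * card B"
  using assms(3,4)
proof (induction B rule: finite_induct)
  case empty
  then show ?case by simp
next
  case (insert b B)
  let ?T = "\<lambda>b. (\<lambda>i. single i 1 + b) ` X"
  let ?O = "Y0 \<union> (\<Union>b\<in>B. ?T b)"
  have "Y0 = (\<lambda>(i, j). \<mu> + single i 1 + single j 1) ` (X \<times> X)"
    unfolding Y0_def by auto
  then have finO: "finite ?O"
    using X insert.hyps(1) by simp
  have "inj_on (\<lambda>i. single i 1 + b) X"
    by (rule inj_onI) (metis add_right_cancel lookup_single_if one_neq_zero)
  then have cardT: "card (?T b) = card X"
    by (rule card_image)
  have "card (?T b \<inter> ?O) \<le> card ((?T b \<inter> Y0) \<union> (\<Union>b'\<in>B. ?T b \<inter> ?T b'))"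
    using X insert.hyps(1) by (intro card_mono) auto
  also have "\<dots> \<le> card (?T b \<inter> Y0) + card (\<Union>b'\<in>B. ?T b \<inter> ?T b')"
    by (rule card_Un_le)
  also have "card (\<Union>b'\<in>B. ?T b \<inter> ?T b') \<le> (\<Sum>b'\<in>B. card (?T b \<inter> ?T b'))"
    by (rule card_UN_le[OF insert.hyps(1)])
  also have "\<dots> \<le> (\<Sum>b'\<in>B. 1)"
  proof (rule sum_mono)
    fix b' assume "b' \<in> B"
    then have "b \<noteq> b'"
      using insert.hyps(2) by blast
    then show "card (?T b \<inter> ?T b') \<le> 1"
      using card_translates_diff[of b b' X] X by simp
  qed
  also have "card (?T b \<inter> Y0) \<le> 1"
    unfolding Y0_def using card_translate_quadratic[of b \<mu> X] insert.prems X by auto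
  finally have inter: "card (?T b \<inter> ?O) \<le> 1 + card B"
    by simp
  have "card ?O + card (?T b) = card (?O \<union> ?T b) + card (?O \<inter> ?T b)"
    using finO X by (intro card_Un_Int) auto
  then have "card ?O + card X \<le> card (?O \<union> ?T b) + (1 + card B)"
    using inter cardT by (simp add: Int_commute)
  moreover have "card Y0 + card X * card B \<le> card ?O + card B * card B"
    using insert.IH insert.prems by blast
  moreover have "Y0 \<union> (\<Union>b\<in>insert b B. ?T b) = ?O \<union> ?T b"
    by blast
  moreover have "card (insert b B) = Suc (card B)"
    using insert.hyps by simp
  ultimately show ?case
    by (simp add: algebra_simps)
qed

definition quadratic_monomials :: "nat \<Rightarrow> (nat \<Rightarrow>\<^sub>0 nat) set" where
  "quadratic_monomials n = {single i 1 + single j 1 | i j. i < n \<and> j < n}"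

text \<open>
  The two indices are both in \<open>X\<close>, or one of them is, or none is. The first kind is counted after
  translation by \<open>\<mu>\<close>, in the form in which it occurs among the leading monomials; for the last
  kind the number of ordered pairs is a sufficient bound.
\<close>

lemma card_quadratic_monomials_le:
  fixes \<mu> :: "nat \<Rightarrow>\<^sub>0 nat"
  assumes X: "X \<subseteq> {..<n}"
  defines "g \<equiv> card ({..<n} - X)"
  shows "finite (quadratic_monomials n)"
    and "card (quadratic_monomials n) \<le>
      card {\<mu> + single i 1 + single j 1 | i j. i \<in> X \<and> j \<in> X} + card X * g + g * g"
proof -
  define s :: "nat \<times> nat \<Rightarrow> nat \<Rightarrow>\<^sub>0 nat" where "s = (\<lambda>(i, j). single i 1 + single j 1)"
  let ?G = "{..<n} - X"
  have finX: "finite X"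
    using X finite_subset by blast
  have sub: "quadratic_monomials n \<subseteq> s ` (X \<times> X) \<union> s ` (X \<times> ?G) \<union> s ` (?G \<times> ?G)"
  proof
    fix m assume "m \<in> quadratic_monomials n"
    then obtain i j where ij: "m = single i 1 + single j 1" "i < n" "j < n"
      unfolding quadratic_monomials_def by blast
    then have "m = s (i, j)" "m = s (j, i)"
      by (simp_all add: s_def add.commute)
    moreover have "(i, j) \<in> X \<times> X \<union> X \<times> ?G \<union> ?G \<times> ?G \<or> (j, i) \<in> X \<times> ?G"
      using ij by auto
    ultimately show "m \<in> s ` (X \<times> X) \<union> s ` (X \<times> ?G) \<union> s ` (?G \<times> ?G)"
      by blast
  qed
  have fin: "finite (s ` (X \<times> X) \<union> s ` (X \<times> ?G) \<union> s ` (?G \<times> ?G))"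
    using finX by simp
  then show "finite (quadratic_monomials n)"
    using sub by (rule rev_finite_subset)
  have "card (quadratic_monomials n) \<le> card (s ` (X \<times> X) \<union> s ` (X \<times> ?G) \<union> s ` (?G \<times> ?G))"
    using fin sub by (rule card_mono)
  also have "\<dots> \<le> card (s ` (X \<times> X)) + card (s ` (X \<times> ?G)) + card (s ` (?G \<times> ?G))"
    by (intro order.trans[OF card_Un_le] add_mono card_Un_le order.refl)
  also have "card (s ` (X \<times> ?G)) \<le> card X * g"
    unfolding g_def using finX by (intro order.trans[OF card_image_le]) (simp_all add: card_cartesian_product)
  also have "card (s ` (?G \<times> ?G)) \<le> g * g"
    unfolding g_def by (intro order.trans[OF card_image_le]) (simp_all add: card_cartesian_product)
  also have "card (s ` (X \<times> X)) = card ((+) \<mu> ` s ` (X \<times> X))"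
    by (intro card_image[symmetric]) (auto simp: inj_on_def)
  also have "(+) \<mu> ` s ` (X \<times> X) = {\<mu> + single i 1 + single j 1 | i j. i \<in> X \<and> j \<in> X}"
    unfolding s_def by (force simp: add.assoc)
  finally show "card (quadratic_monomials n) \<le>
      card {\<mu> + single i 1 + single j 1 | i j. i \<in> X \<and> j \<in> X} + card X * g + g * g"
    by simp
qed

section \<open>Quadrics are spanned by products of two variables\<close>

lemma total_degree_eq_sum: "finite F \<Longrightarrow> keys m \<subseteq> F \<Longrightarrow> total_degree m = (\<Sum>i\<in>F. lookup m i)"
  unfolding total_degree_def by (rule sum.mono_neutral_left) (auto simp: in_keys_iff)

lemma total_degree_add: "total_degree (a + b) = total_degree a + total_degree b"
  using total_degree_eq_sum[of "keys a \<union> keys b" a] total_degree_eq_sum[of "keys a \<union> keys b" b]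
    total_degree_eq_sum[of "keys a \<union> keys b" "a + b"]
  by (simp add: keys_exponent_add lookup_add sum.distrib)

lemma total_degree_single [simp]: "total_degree (single i e) = e"
  by (simp add: total_degree_def)

lemma total_degree_eq_0_iff: "total_degree m = 0 \<longleftrightarrow> m = 0"
  by (auto simp: total_degree_def in_keys_iff simp flip: keys_eq_empty)

lemma total_degree_SucE:
  assumes "total_degree m = Suc d"
  obtains i m' where "i \<in> keys m" "m = m' + single i 1" "total_degree m' = d"
proof -
  have "m \<noteq> 0"
    using assms total_degree_eq_0_iff[of m] by auto
  then obtain i where i: "i \<in> keys m"
    by (metis equals0I keys_eq_empty)
  have m: "m = (m - single i 1) + single i 1"
    using i by (intro poly_mapping_eqI) (auto simp: in_keys_iff lookup_add lookup_minus lookup_single_if)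
  have "total_degree m = total_degree (m - single i 1) + 1"
    using total_degree_add[of "m - single i 1" "single i 1"] m by simp
  then show ?thesis
    using that[OF i m] assms by simp
qed

lemma graded_part_2_subset:
  assumes "I \<subseteq> carrier (mpoly_ring n)"
  shows "graded_part 2 I \<subseteq> supported_on (quadratic_monomials n)"
proof
  fix p assume "p \<in> graded_part 2 I"
  then have p: "p \<in> carrier (mpoly_ring n)" "\<forall>m\<in>keys p. total_degree m = 2"
    using assms by (auto simp: graded_part_def homogeneous_def)
  have "m \<in> quadratic_monomials n" if m: "m \<in> keys p" for m
  proof -
    have deg: "total_degree m = Suc (Suc 0)"
      using p(2) m by simp
    have n: "keys m \<subseteq> {..<n}"
      using p(1) m by (simp add: mpoly_ring_def)
    obtain i m' where m': "m = m' + single i 1" "total_degree m' = Suc 0"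
      using deg by (rule total_degree_SucE)
    obtain j m'' where m'': "m' = m'' + single j 1" "total_degree m'' = 0"
      using m'(2) by (rule total_degree_SucE)
    have "m = single j 1 + single i 1"
      using m' m'' by (simp add: total_degree_eq_0_iff)
    moreover have "i < n" "j < n"
      using n unfolding \<open>m = single j 1 + single i 1\<close> keys_exponent_add by simp_all
    ultimately show ?thesis
      unfolding quadratic_monomials_def by blast
  qed
  then show "p \<in> supported_on (quadratic_monomials n)"
    unfolding supported_on_def by blast
qed

section \<open>Quadrics in nondegenerate prime ideals\<close>

lemma single_one_eq_iff: "single i (1::nat) = single j 1 \<longleftrightarrow> i = j"
  using inj_single_one[where 'k=nat] by (rule inj_eq)

definition linear_forms :: "nat \<Rightarrow> 'k::zero mpoly set" where
  "linear_forms n = supported_on ((\<lambda>v. single v 1) ` {..<n})"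

lemma linear_form_eq_sum:
  assumes "w \<in> linear_forms n"
  shows "w = (\<Sum>v<n. mpoly_smult (lookup w (single v 1)) (pvar v))"
proof (rule poly_mapping_eqI)
  fix m
  let ?r = "\<Sum>v<n. lookup w (single v 1) * (if single v (1::nat) = m then 1 else 0)"
  have "lookup w m = ?r"
  proof (cases "m \<in> (\<lambda>v. single v 1) ` {..<n}")
    case True
    then obtain v where v: "m = single v 1" "v < n"
      by blast
    have "single x (1::nat) = m \<longleftrightarrow> x = v" for x
      unfolding v(1) by (rule single_one_eq_iff)
    then have "?r = (\<Sum>x<n. if x = v then lookup w m else 0)"
      using v(1) by (intro sum.cong) auto
    then show ?thesis
      using v(2) by simp
  next
    case False
    then have "?r = (\<Sum>v<n. 0)"
      by (intro sum.cong) auto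
    moreover have "lookup w m = 0"
      using False assms by (auto simp: linear_forms_def supported_on_def in_keys_iff)
    ultimately show ?thesis
      by simp
  qed
  then show "lookup w m = lookup (\<Sum>v<n. mpoly_smult (lookup w (single v 1)) (pvar v)) m"
    by (simp add: lookup_sum lookup_mpoly_smult lookup_single_if)
qed

lemma nondegenerate_linear_form:
  assumes "nondegenerate P" "w \<in> P" "w \<in> linear_forms n"
  shows "w = 0"
proof -
  have "homogeneous 1 w"
    using assms(3) unfolding homogeneous_def linear_forms_def supported_on_def by auto
  then show ?thesis
    using assms(1,2) unfolding nondegenerate_def by blast
qed

text \<open>
  Sending \<open>w\<close> to the representative of \<open>D * w\<close> is linear on the linear forms. It is injective because
  \<open>P\<close> is prime and contains neither \<open>D\<close> nor a nonzero linear form, so at least \<open>n\<close> leading monomials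
  occur. For \<open>i \<in> X\<close> the representative of \<open>D * x\<^sub>i\<close> is this product itself, which makes the part of
  \<open>A\<close> coming from \<open>X\<close> explicit.
\<close>

lemma leading_monomials_of_linear_forms:
  fixes P :: "'k::field mpoly set"
  assumes P: "primeideal P (mpoly_ring n)" and nd: "nondegenerate P" and X: "X \<subseteq> {..<n}"
    and D: "D \<in> supported_on (monomials_in X)" "D \<notin> P"
    and dens: "\<And>y. y \<in> {..<n} - X \<Longrightarrow> \<exists>u\<in>supported_on (affine_monomials X Z). D * pvar y - u \<in> P"
  obtains A where "finite A" "n \<le> card A" "(\<lambda>i. lead D + single i 1) ` X \<subseteq> A"
    "\<And>a. a \<in> A \<Longrightarrow> \<exists>w\<in>linear_forms n. \<exists>u\<in>supported_on (affine_monomials X Z).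
      u \<noteq> 0 \<and> lead u = a \<and> D * w - u \<in> P"
proof -
  note ideal = primeideal.axioms(1)[OF P]
  let ?U = "supported_on (affine_monomials X Z) :: 'k mpoly set"
  have "\<exists>u\<in>?U. D * pvar v - u \<in> P \<and> (v \<in> X \<longrightarrow> u = D * pvar v)" if "v < n" for v
  proof (cases "v \<in> X")
    case True
    have "pvar v * D \<in> ?U"
    proof (rule supported_on_affine_mult)
      show "pvar v \<in> supported_on (monomials_in X)"
        using True by (auto simp: supported_on_def monomials_in_def)
      show "D \<in> ?U"
        using D(1) by (rule supported_on_mono) (auto simp: affine_monomials_def)
    qed
    then show ?thesis
      using mpoly_ideal_zero[OF ideal] by (intro bexI[of _ "D * pvar v"]) (simp_all add: mult.commute)
  next
    case False
    then show ?thesis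
      using dens[of v] that by auto
  qed
  then obtain u where u: "\<And>v. v < n \<Longrightarrow> u v \<in> ?U" "\<And>v. v < n \<Longrightarrow> D * pvar v - u v \<in> P"
    and uX: "\<And>v. v \<in> X \<Longrightarrow> u v = D * pvar v"
    using X by (metis lessThan_iff subsetD)
  define N :: "'k mpoly \<Rightarrow> 'k mpoly" where
    "N = (\<lambda>w. \<Sum>v<n. mpoly_smult (lookup w (single v 1)) (u v))"
  define A where "A = (\<lambda>w. lead (N w)) ` (linear_forms n - {0})"
  have carrier: "p \<in> carrier (mpoly_ring n)" if "p \<in> supported_on (monomials_in X)" for p :: "'k mpoly"
    unfolding carrier_mpoly_ring using that
    by (rule supported_on_mono) (use X in \<open>auto simp: monomials_in_def\<close>)
  have linear_carrier: "w \<in> carrier (mpoly_ring n)" if "w \<in> linear_forms n" for w :: "'k mpoly"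
    unfolding carrier_mpoly_ring using that unfolding linear_forms_def
    by (rule supported_on_mono) (auto simp: monomials_in_def)
  have NU: "N w \<in> ?U" for w
    unfolding N_def
    by (intro mp.subspace_sum mp.subspace_scale subspace_supported_on) (use u(1) in auto)
  have NP: "D * w - N w \<in> P" if w: "w \<in> linear_forms n" for w
  proof -
    have "D * w = (\<Sum>v<n. mpoly_smult (lookup w (single v 1)) (D * pvar v))"
      by (subst linear_form_eq_sum[OF w])
        (simp add: sum_distrib_left mpoly_smult_conv_mult mult.left_commute)
    then have "D * w - N w = (\<Sum>v<n. single 0 (lookup w (single v 1)) * (D * pvar v - u v))"
      unfolding N_def by (simp add: mpoly_smult_conv_mult right_diff_distrib sum_subtractf)
    moreover have "(\<Sum>v<n. single 0 (lookup w (single v 1)) * (D * pvar v - u v)) \<in> P"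
      using u(2) by (intro mpoly_ideal_sum[OF ideal] mpoly_ideal_mult[OF ideal]) simp_all
    ultimately show ?thesis by metis
  qed
  have inj: "w = 0" if w: "w \<in> linear_forms n" "N w = 0" for w
  proof -
    have "D * w \<in> P"
      using NP[OF w(1)] w(2) by simp
    then have "w \<in> P"
      using mpoly_primeideal_mult_iff[OF P carrier[OF D(1)] linear_carrier[OF w(1)]] D(2) by blast
    then show ?thesis
      using nd w(1) nondegenerate_linear_form by blast
  qed
  let ?K = "\<Union>v<n. keys (u v)"
  have K: "keys (N w) \<subseteq> ?K" for w
  proof
    fix m assume m: "m \<in> keys (N w)"
    show "m \<in> ?K"
    proof (rule ccontr)
      assume "m \<notin> ?K"
      then have "lookup (N w) m = 0"
        unfolding N_def by (simp add: lookup_sum lookup_mpoly_smult in_keys_iff)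
      then show False
        using m by (simp add: in_keys_iff)
    qed
  qed
  have A_rep: "\<exists>w\<in>linear_forms n. \<exists>u\<in>?U. u \<noteq> 0 \<and> lead u = a \<and> D * w - u \<in> P" if "a \<in> A" for a
    using that NU NP inj unfolding A_def by blast
  have "A \<subseteq> ?K"
    unfolding A_def using inj K lead_in_keys by blast
  then have "finite A"
    by (rule finite_subset) simp
  moreover have "n \<le> card A"
  proof -
    let ?B = "(\<lambda>m. single m 1) ` (\<lambda>v. single v 1) ` {..<n} :: 'k mpoly set"
    have inj_v: "inj (\<lambda>v::nat. single v (1::nat))"
      by (rule inj_single_one)
    have "card ?B = n"
      using inj_single_one[where 'k='k] inj_v
      by (subst card_image, force dest: inj_on_subset, subst card_image, force dest: inj_on_subset, simp)
    moreover have "card ?B \<le> card A"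
      unfolding A_def
    proof (rule card_le_card_leads)
      show "mp.subspace (linear_forms n)"
        unfolding linear_forms_def by (rule subspace_supported_on)
      show "N (v - mpoly_smult c w) = N v - mpoly_smult c (N w)" for v w c
        unfolding N_def
        by (simp add: lookup_minus lookup_mpoly_smult mp.scale_left_diff_distrib sum_subtractf
            mp.scale_sum_right)
      show "mp.independent ?B"
        by (rule independent_monomials)
      show "?B \<subseteq> linear_forms n"
        by (auto simp: linear_forms_def supported_on_def)
      show "finite ?K"
        by simp
    qed (use inj K in auto)
    ultimately show ?thesis
      by simp
  qed
  moreover have "(\<lambda>i. lead D + single i 1) ` X \<subseteq> A"
  proof (rule image_subsetI)
    fix i assume i: "i \<in> X"
    have iN: "i < n"
      using i X by blast
    have "D \<noteq> 0"
      using D(2) mpoly_ideal_zero[OF ideal] by blast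
    have "lookup (pvar i :: 'k mpoly) (single v 1) = (if v = i then 1 else 0)" for v
      by (auto simp: lookup_single_if single_one_eq_iff simp del: One_nat_def)
    then have "N (pvar i) = (\<Sum>v<n. if v = i then u i else 0)"
      unfolding N_def by (intro sum.cong) simp_all
    also have "\<dots> = single (single i 1) 1 * D"
      using iN uX[OF i] by (simp add: mult.commute)
    finally have "lead (N (pvar i)) = lead D + single i 1"
      using lead_monomial_times(1)[OF \<open>D \<noteq> 0\<close>, of "single i 1"] by (simp add: add.commute)
    moreover have "pvar i \<in> linear_forms n - {0 :: 'k mpoly}"
      using iN keys_single[of "single i 1" "1 :: 'k"] keys_zero
      unfolding linear_forms_def supported_on_def by fastforce
    then have "lead (N (pvar i)) \<in> A"
      unfolding A_def by (rule imageI)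
    ultimately show "lead D + single i 1 \<in> A"
      by simp
  qed
  ultimately show ?thesis
    using A_rep by (rule that)
qed

lemma linear_times_linear:
  assumes "p \<in> linear_forms n" "q \<in> linear_forms n"
  shows "p * q \<in> supported_on (quadratic_monomials n)"
  using assms unfolding linear_forms_def
  by (rule supported_on_mult) (auto simp: quadratic_monomials_def)

theorem theoremB:
  fixes P :: "'k::field mpoly set" and n h :: nat
  assumes "primeideal P (mpoly_ring n)"
    and "homogeneous_ideal n P"
    and "nondegenerate P"
    and "height (mpoly_ring n) P = enat h"
  shows "vector_space.dim mpoly_smult (graded_part 2 P) \<le> 2 * h\<^sup>2 + h"
proof -
  note P = assms(1)
  note ideal = primeideal.axioms(1)[OF P]
  obtain X where X: "X \<subseteq> {..<n}" and codim: "card ({..<n} - X) \<le> h"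
    and PX: "P \<inter> supported_on (monomials_in X) \<subseteq> {0}"
    using exists_independent_variables[OF P assms(4)] by blast
  define g where "g = card ({..<n} - X)"
  have finX: "finite X"
    using X finite_subset by blast
  have n_eq: "n = card X + g"
    using card_Diff_subset[OF finX X] card_mono[OF _ X] by (simp add: g_def)
  obtain Z D where D: "D \<in> supported_on (monomials_in X)" "D \<notin> P"
    and PU: "P \<inter> supported_on (affine_monomials X Z) \<subseteq> {0}"
    and dens: "\<forall>y\<in>{..<n} - X. \<exists>u\<in>supported_on (affine_monomials X Z). D * pvar y - u \<in> P"
    using exists_common_denominator[OF P X PX, of "{..<n} - X"] by auto
  let ?U = "supported_on (affine_monomials X Z) :: 'k mpoly set"
  let ?x = "\<lambda>i. single i 1 :: nat \<Rightarrow>\<^sub>0 nat"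
  have D_carrier: "D \<in> carrier (mpoly_ring n)"
    unfolding carrier_mpoly_ring using D(1)
    by (rule supported_on_mono) (use X in \<open>auto simp: monomials_in_def\<close>)
  obtain A where A: "finite A" "n \<le> card A" "(\<lambda>i. lead D + ?x i) ` X \<subseteq> A"
    and A_rep: "\<And>a. a \<in> A \<Longrightarrow> \<exists>w\<in>linear_forms n. \<exists>u\<in>?U. u \<noteq> 0 \<and> lead u = a \<and> D * w - u \<in> P"
    using leading_monomials_of_linear_forms[OF P assms(3) X D, of Z] dens by blast
  have "card ((\<lambda>i. lead D + ?x i) ` X) = card X"
    by (intro card_image inj_onI) (simp add: single_one_eq_iff del: One_nat_def)
  then have "g \<le> card (A - (\<lambda>i. lead D + ?x i) ` X)"
    using A n_eq finX by (subst card_Diff_subset) auto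
  then obtain B where B: "B \<subseteq> A - (\<lambda>i. lead D + ?x i) ` X" "card B = g" "finite B"
    by (rule obtain_subset_with_card_n)
  \<comment> \<open>Leading exponents of representatives of \<open>D * x\<^sub>i * w\<close> with \<open>i \<in> X\<close>: those in \<open>Y0\<close> come from
    the variables \<open>w = x\<^sub>j\<close> with \<open>j \<in> X\<close>, the others from \<open>g\<close> further linear forms \<open>w\<close>.\<close>
  define Y0 where "Y0 = {lead D + ?x i + ?x j | i j. i \<in> X \<and> j \<in> X}"
  define Y where "Y = Y0 \<union> (\<Union>b\<in>B. (\<lambda>i. ?x i + b) ` X)"
  have Y_sumset: "\<exists>i\<in>X. \<exists>a\<in>A. c = ?x i + a" if "c \<in> Y" for c
    using that
  proof (unfold Y_def, elim UnE)
    assume "c \<in> Y0"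
    then obtain i j where ij: "i \<in> X" "j \<in> X" "c = lead D + ?x i + ?x j"
      unfolding Y0_def by blast
    then have "lead D + ?x i \<in> A" "c = ?x j + (lead D + ?x i)"
      using A(3) by (auto simp: add.commute)
    then show ?thesis
      using ij(2) by blast
  next
    assume "c \<in> (\<Union>b\<in>B. (\<lambda>i. ?x i + b) ` X)"
    then show ?thesis
      using B(1) by blast
  qed
  have "\<exists>q\<in>supported_on (quadratic_monomials n). \<exists>u\<in>?U. u \<noteq> 0 \<and> lead u = c \<and> D * q - u \<in> P"
    if cY: "c \<in> Y" for c
  proof -
    obtain i a where i: "i \<in> X" and a: "a \<in> A" and c: "c = ?x i + a"
      using Y_sumset[OF cY] by blast
    obtain w u where w: "w \<in> linear_forms n" and u: "u \<in> ?U" "u \<noteq> 0" "lead u = a" "D * w - u \<in> P"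
      using A_rep[OF a] by blast
    have "D * (pvar i * w) - pvar i * u = pvar i * (D * w - u)"
      by (simp add: algebra_simps)
    moreover have "pvar i * (D * w - u) \<in> P"
      using i X by (intro mpoly_ideal_mult[OF ideal _ u(4)]) (auto simp: mpoly_ring_def)
    ultimately have "D * (pvar i * w) - pvar i * u \<in> P"
      by simp
    moreover have "pvar i * u \<in> ?U"
      using i by (intro supported_on_affine_mult[OF _ u(1)]) (auto simp: supported_on_def monomials_in_def)
    moreover have "pvar i * w \<in> supported_on (quadratic_monomials n)"
      using i X w by (intro linear_times_linear) (auto simp: linear_forms_def supported_on_def)
    ultimately show ?thesis
      using lead_monomial_times[OF u(2), of "?x i"] u(3) c by blast
  qed
  then obtain q where q: "\<And>c. c \<in> Y \<Longrightarrow> q c \<in> supported_on (quadratic_monomials n)"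
    and q_rep: "\<And>c. c \<in> Y \<Longrightarrow> \<exists>u\<in>?U. u \<noteq> 0 \<and> lead u = c \<and> D * q c - u \<in> P"
    by metis
  let ?M = "(\<lambda>m. single m 1) ` quadratic_monomials n :: 'k mpoly set"
  have finM: "finite (quadratic_monomials n)"
    using card_quadratic_monomials_le(1)[OF X] .
  obtain G where G: "G \<subseteq> graded_part 2 P" "mp.independent G" "graded_part 2 P \<subseteq> mp.span G"
    "card G = mp.dim (graded_part 2 P)"
    by (rule mp.basis_exists)
  have GP: "G \<subseteq> P"
    using G(1) by (auto simp: graded_part_def)
  have GM: "G \<subseteq> mp.span ?M"
    using G(1) graded_part_2_subset[OF mpoly_ideal_subset[OF ideal]]
    unfolding supported_on_eq_span[symmetric] by blast
  have finG: "finite G"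
    using mp.independent_span_bound[OF finite_imageI[OF finM] G(2) GM] by (rule conjunct1)
  have "Y0 = (\<lambda>(i, j). lead D + ?x i + ?x j) ` (X \<times> X)"
    unfolding Y0_def by auto
  then have finY: "finite Y"
    unfolding Y_def using finX B(3) by simp
  have indep: "mp.independent (G \<union> q ` Y)" and card: "card (G \<union> q ` Y) = card G + card Y"
    using independent_Un_leads[OF ideal D_carrier subspace_supported_on PU G(2) GP finG finY q_rep]
    by simp_all
  have span: "G \<union> q ` Y \<subseteq> mp.span ?M"
    using GM q unfolding supported_on_eq_span[symmetric] by blast
  have "card (G \<union> q ` Y) \<le> card ?M"
    using mp.independent_span_bound[OF finite_imageI[OF finM] indep span] by (rule conjunct2)
  also have "\<dots> \<le> card (quadratic_monomials n)"
    using finM by (rule card_image_le)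
  also have "\<dots> \<le> card Y0 + card X * g + g * g"
    using card_quadratic_monomials_le(2)[OF X, of "lead D"] unfolding Y0_def g_def .
  finally have "card G + card Y \<le> card Y0 + card X * g + g * g"
    unfolding card .
  moreover have "card Y0 + card X * g \<le> card Y + g * g"
    using card_sumset_ge[OF finX B(3), of "lead D"] B(1,2) unfolding Y_def Y0_def by blast
  ultimately have "card G \<le> 2 * (g * g)"
    by simp
  also have "g * g \<le> h * h"
    using codim unfolding g_def by (intro mult_mono) simp_all
  finally show ?thesis
    unfolding G(4)[symmetric] by (simp add: power2_eq_square)
qed

end
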